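(* There exists an $n$-variate homogeneous polynomial $f$ of degree $4$ with non-negative coefficients such that $\|f\|_2\le(\log n)^{O(1)}$ and $\Lambda(f)\ge\tilde{\Omega}(n^{1/6})$.
   Context: $\|f\|_2:=\sup_{\|x\|_2=1}|f(x)|$. A matrix representation of a homogeneous degree-4 polynomial $f$ is a symmetric $M\in\mathbb{R}^{[n]^2\times[n]^2}$ with $(x\otimes x)^TM(x\otimes x)=f(x)$ for all $x$; $\Lambda(f):=\inf\{\sup_{\|z\|_2=1}z^TMz:\ M\text{ a matrix representation of }f\}$. $\tilde{\Omega}$ hides polylogarithmic factors in $n$. *)

theory Defs
  imports "HOL-Analysis.Analysis" "HOL-Library.Poly_Mapping"
begin

text \<open>
  Real multivariate polynomials are finitely supported maps from monomials to coefficients; a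
  monomial is a finitely supported map from variable indices to exponents. The dimension \<open>n\<close> is
  an argument, so vectors in \<open>\<real>\<^sup>n\<close> are functions on \<open>nat\<close> of which only the values on \<open>{..<n}\<close>
  matter, and \<open>[n]\<close> is \<open>{..<n}\<close>. Similarly, only the entries of a matrix whose row and column
  indices lie in the stated index set matter.
\<close>

type_synonym mpoly = "(nat \<Rightarrow>\<^sub>0 nat) \<Rightarrow>\<^sub>0 real"

definition poly_eval :: "mpoly \<Rightarrow> (nat \<Rightarrow> real) \<Rightarrow> real" where
  "poly_eval f x =
     (\<Sum>m\<in>Poly_Mapping.keys f. Poly_Mapping.lookup f m *
       (\<Prod>i\<in>Poly_Mapping.keys m. x i ^ Poly_Mapping.lookup m i))"

definition homogeneous_poly :: "nat \<Rightarrow> nat \<Rightarrow> mpoly \<Rightarrow> bool" where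
  "homogeneous_poly n d f \<longleftrightarrow>
     (\<forall>m\<in>Poly_Mapping.keys f. Poly_Mapping.keys m \<subseteq> {..<n} \<and>
       (\<Sum>i\<in>Poly_Mapping.keys m. Poly_Mapping.lookup m i) = d)"

definition nonneg_coeffs :: "mpoly \<Rightarrow> bool" where
  "nonneg_coeffs f \<longleftrightarrow> (\<forall>m. Poly_Mapping.lookup f m \<ge> 0)"

definition poly_norm2 :: "nat \<Rightarrow> mpoly \<Rightarrow> real" where
  "poly_norm2 n f = (SUP x\<in>{x. L2_set x {..<n} = 1}. \<bar>poly_eval f x\<bar>)"

definition quad_form :: "'i set \<Rightarrow> ('i \<Rightarrow> 'i \<Rightarrow> real) \<Rightarrow> ('i \<Rightarrow> real) \<Rightarrow> real" where
  "quad_form I M z = (\<Sum>a\<in>I. \<Sum>b\<in>I. z a * M a b * z b)"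

definition tensor_sq :: "(nat \<Rightarrow> real) \<Rightarrow> nat \<times> nat \<Rightarrow> real" where
  "tensor_sq x = (\<lambda>(i, j). x i * x j)"

definition matrix_rep ::
  "nat \<Rightarrow> mpoly \<Rightarrow> (nat \<times> nat \<Rightarrow> nat \<times> nat \<Rightarrow> real) \<Rightarrow> bool" where
  "matrix_rep n f M \<longleftrightarrow>
     (\<forall>a\<in>{..<n} \<times> {..<n}. \<forall>b\<in>{..<n} \<times> {..<n}. M a b = M b a) \<and>
     (\<forall>x. quad_form ({..<n} \<times> {..<n}) M (tensor_sq x) = poly_eval f x)"

text \<open>
  For \<open>n \<ge> 1\<close> and homogeneous \<open>f\<close> of degree 4, the suprema and the infimum used here are over
  nonempty sets of reals bounded on the relevant side, so they are the usual ones.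
\<close>

definition Lambda_rep :: "nat \<Rightarrow> mpoly \<Rightarrow> real" where
  "Lambda_rep n f =
     (INF M\<in>{M. matrix_rep n f M}.
        SUP z\<in>{z. L2_set z ({..<n} \<times> {..<n}) = 1}. quad_form ({..<n} \<times> {..<n}) M z)"

end

theory Submission
  imports Defs
begin

text \<open>
  Identify the vertices with \<open>\<bbbF>\<^sub>2\<^sup>k\<close>, \<open>k = 3 * m\<close>, written as the numbers below \<open>N = 2 ^ k\<close> under bitwise
  XOR, put \<open>q = 2 ^ m = N powr (1/3)\<close>, and choose a random set \<open>S\<close> of nonzero vertices of density
  \<open>1 / (2 * q)\<close>. The polynomial is the sum of \<open>x i * x j * x u * x v\<close> over the quadruples with XOR
  zero all of whose pairwise XORs lie in \<open>S\<close>; these are 4-cliques of the Cayley graph of \<open>S\<close>.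

  Any three vertices of this graph have \<open>O(m)\<close> common neighbours, since \<open>N / q ^ 3\<close> is bounded, and
  this alone bounds the 2-norm. Order a clique so that
  \<open>h v \<ge> h u \<ge> h w \<ge> h z\<close>; the sum over \<open>z\<close> costs \<open>O(m) * h w\<close>, the sum over \<open>u\<close> and \<open>w\<close> is bounded by
  Cauchy-Schwarz by the power \<open>3/2\<close> of the mass \<open>H v\<close> of the neighbours lighter than \<open>v\<close>, and the
  sum of the \<open>(H v) ^ 3\<close> counts common neighbours of triples.

  For the lower bound, a symmetric tensor \<open>X\<close> that is positive semidefinite as a matrix on pairs
  gives \<open>\<langle>f, X\<rangle> \<le> \<Lambda>(f) * trace X\<close>, because by polarization \<open>\<langle>M, X\<rangle>\<close> is the same for all
  representations \<open>M\<close> of \<open>f\<close>. Let \<open>X\<close> be 1 on the chosen cliques, \<open>L\<close> on \<open>(x i)\<^sup>2 * (x j)\<^sup>2\<close> for edges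
  \<open>ij\<close>, and \<open>L * card S\<close> on \<open>(x i) ^ 4\<close>. It is block diagonal along \<open>i \<oplus> j = s\<close>, and each block is a
  convolution operator on \<open>\<bbbF>\<^sub>2\<^sup>k\<close>, diagonalised by the Walsh characters. Positivity reduces to
  \<open>(\<Sum>t | t \<in> S \<and> s \<oplus> t \<in> S. \<chi> t) \<ge> - 2 * L\<close>, which holds for \<open>L\<close> of order \<open>m * sqrt q\<close> by a Chernoff
  bound for each \<open>s\<close> and \<open>\<chi>\<close>. As each \<open>s\<close> lies on about \<open>q\<close> triangles, \<open>\<Lambda>(f)\<close> is at least of order
  \<open>q / L\<close>, that is, \<open>N powr (1/6) / m\<close>.
\<close>

notation Bit_Operations.xor (infixl "\<oplus>" 60)

section \<open>Clique sums in graphs without \<open>K\<^bsub>3,t+1\<^esub>\<close>\<close>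

definition quad_sum :: "'a set \<Rightarrow> ('a \<Rightarrow> 'a \<Rightarrow> 'a \<Rightarrow> 'a \<Rightarrow> real) \<Rightarrow> real" where
  "quad_sum V g = (\<Sum>a\<in>V. \<Sum>b\<in>V. \<Sum>c\<in>V. \<Sum>d\<in>V. g a b c d)"

lemma quad_sum_swap12: "quad_sum V (\<lambda>a b c d. g b a c d) = quad_sum V g"
  unfolding quad_sum_def by (rule sum.swap)

lemma quad_sum_swap23: "quad_sum V (\<lambda>a b c d. g a c b d) = quad_sum V g"
  unfolding quad_sum_def by (rule sum.cong[OF refl], rule sum.swap)

lemma quad_sum_swap34: "quad_sum V (\<lambda>a b c d. g a b d c) = quad_sum V g"
  unfolding quad_sum_def by (rule sum.cong[OF refl], rule sum.cong[OF refl], rule sum.swap)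

lemma quad_sum_swap13: "quad_sum V (\<lambda>a b c d. g c b a d) = quad_sum V g"
  using quad_sum_swap12[of V "\<lambda>a b c d. g c a b d"] quad_sum_swap23[of V "\<lambda>a b c d. g b a c d"]
    quad_sum_swap12[of V g] by simp

lemma quad_sum_swap24: "quad_sum V (\<lambda>a b c d. g a d c b) = quad_sum V g"
  using quad_sum_swap23[of V "\<lambda>a b c d. g a d b c"] quad_sum_swap34[of V "\<lambda>a b c d. g a c b d"]
    quad_sum_swap23[of V g] by simp

lemma quad_sum_swap14: "quad_sum V (\<lambda>a b c d. g d b c a) = quad_sum V g"
  using quad_sum_swap12[of V "\<lambda>a b c d. g d a c b"] quad_sum_swap24[of V "\<lambda>a b c d. g b a c d"]
    quad_sum_swap12[of V g] by simp

lemma quad_sum_mono: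
  assumes "\<And>a b c d. \<lbrakk>a \<in> V; b \<in> V; c \<in> V; d \<in> V\<rbrakk> \<Longrightarrow> f a b c d \<le> g a b c d"
  shows "quad_sum V f \<le> quad_sum V g"
  unfolding quad_sum_def by (intro sum_mono assms)

lemma quad_sum_add: "quad_sum V (\<lambda>a b c d. f a b c d + g a b c d) = quad_sum V f + quad_sum V g"
  unfolding quad_sum_def by (simp add: sum.distrib)

text \<open>Some variable has the largest \<open>h\<close>, another the largest among the remaining
  three, and so on. \<open>Q1\<close>, \<open>Q2\<close>, \<open>Q3\<close> fix these choices one
  place at a time, at costs 4, 3 and 2; the symmetry of \<open>P\<close> moves every case to the
  standard order. Ties are counted repeatedly, hence an inequality.\<close>

lemma quad_sum_le_ordered:
  fixes h :: "'a \<Rightarrow> real" and P :: "'a \<Rightarrow> 'a \<Rightarrow> 'a \<Rightarrow> 'a \<Rightarrow> real"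
  assumes nonneg: "\<And>a b c d. P a b c d \<ge> 0"
    and sym: "\<And>a b c d. P a b c d = P b a c d" "\<And>a b c d. P a b c d = P a c b d"
      "\<And>a b c d. P a b c d = P a b d c"
  shows "quad_sum V P \<le> 24 * quad_sum V (\<lambda>a b c d. of_bool (h b \<le> h a \<and> h c \<le> h b \<and> h d \<le> h c) * P a b c d)"
proof -
  have sym13: "P c b a d = P a b c d" and sym14: "P d b c a = P a b c d"
    and sym24: "P a d c b = P a b c d" for a b c d
    by (metis sym)+
  define Q1 where "Q1 = (\<lambda>a b c d. of_bool (h b \<le> h a \<and> h c \<le> h a \<and> h d \<le> h a) * P a b c d)"
  define Q2 where "Q2 = (\<lambda>a b c d. of_bool (h b \<le> h a \<and> h c \<le> h b \<and> h d \<le> h b) * P a b c d)"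
  define Q3 where "Q3 = (\<lambda>a b c d. of_bool (h b \<le> h a \<and> h c \<le> h b \<and> h d \<le> h c) * P a b c d)"
  have "quad_sum V P \<le> quad_sum V (\<lambda>a b c d. Q1 a b c d + (Q1 b a c d + (Q1 c b a d + Q1 d b c a)))"
  proof (rule quad_sum_mono)
    fix a b c d
    have "(1::real) \<le> of_bool (h b \<le> h a \<and> h c \<le> h a \<and> h d \<le> h a)
       + (of_bool (h a \<le> h b \<and> h c \<le> h b \<and> h d \<le> h b)
       + (of_bool (h b \<le> h c \<and> h a \<le> h c \<and> h d \<le> h c)
       + of_bool (h b \<le> h d \<and> h c \<le> h d \<and> h a \<le> h d)))" (is "_ \<le> ?R")
      by (auto simp: of_bool_def)
    from mult_right_mono[OF this nonneg[of a b c d]]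
    show "P a b c d \<le> Q1 a b c d + (Q1 b a c d + (Q1 c b a d + Q1 d b c a))"
      unfolding Q1_def by (simp only: sym13[of c b a d] sym14[of d b c a] sym(1)[of b a] ring_distribs)
  qed
  also have "\<dots> = 4 * quad_sum V Q1"
    unfolding quad_sum_add
    using quad_sum_swap12[of V Q1] quad_sum_swap13[of V Q1] quad_sum_swap14[of V Q1] by simp
  finally have 1: "quad_sum V P \<le> 4 * quad_sum V Q1" .
  have "quad_sum V Q1 \<le> quad_sum V (\<lambda>a b c d. Q2 a b c d + (Q2 a c b d + Q2 a d c b))"
  proof (rule quad_sum_mono)
    fix a b c d
    have "(of_bool (h b \<le> h a \<and> h c \<le> h a \<and> h d \<le> h a) :: real)
      \<le> of_bool (h b \<le> h a \<and> h c \<le> h b \<and> h d \<le> h b)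
       + (of_bool (h c \<le> h a \<and> h b \<le> h c \<and> h d \<le> h c)
       + of_bool (h d \<le> h a \<and> h c \<le> h d \<and> h b \<le> h d))"
      by (auto simp: of_bool_def)
    from mult_right_mono[OF this nonneg[of a b c d]]
    show "Q1 a b c d \<le> Q2 a b c d + (Q2 a c b d + Q2 a d c b)"
      unfolding Q1_def Q2_def by (simp only: sym24[of a d c b] sym(2)[of a c b d] ring_distribs)
  qed
  also have "\<dots> = 3 * quad_sum V Q2"
    unfolding quad_sum_add
    using quad_sum_swap23[of V Q2] quad_sum_swap24[of V Q2] by simp
  finally have 2: "quad_sum V Q1 \<le> 3 * quad_sum V Q2" .
  have "quad_sum V Q2 \<le> quad_sum V (\<lambda>a b c d. Q3 a b c d + Q3 a b d c)"
  proof (rule quad_sum_mono)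
    fix a b c d
    have "(of_bool (h b \<le> h a \<and> h c \<le> h b \<and> h d \<le> h b) :: real)
      \<le> of_bool (h b \<le> h a \<and> h c \<le> h b \<and> h d \<le> h c)
       + of_bool (h b \<le> h a \<and> h d \<le> h b \<and> h c \<le> h d)"
      by (auto simp: of_bool_def)
    from mult_right_mono[OF this nonneg[of a b c d]]
    show "Q2 a b c d \<le> Q3 a b c d + Q3 a b d c"
      unfolding Q2_def Q3_def by (simp only: sym(3)[of a b d c] ring_distribs)
  qed
  also have "\<dots> = 2 * quad_sum V Q3"
    unfolding quad_sum_add using quad_sum_swap34[of V Q3] by simp
  finally show ?thesis using 1 2 unfolding Q3_def by linarith
qed

lemma sum_of_bool_eq_card:
  assumes "finite A"
  shows "(\<Sum>x\<in>A. of_bool (P x)) = real (card {x \<in> A. P x})"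
  using assms by (simp add: of_bool_def sum.If_cases Int_def)

section \<open>Weighted neighbourhood sums and the clique bound\<close>

locale k3t_free =
  fixes V :: "'a set" and E :: "'a \<Rightarrow> 'a \<Rightarrow> bool" and t :: nat
  assumes finV: "finite V"
    and E_sym: "\<And>x y. E x y \<Longrightarrow> E y x"
    and E_irrefl: "\<And>x. \<not> E x x"
    and common: "\<And>a b c. \<lbrakk>a \<in> V; b \<in> V; c \<in> V; a \<noteq> b; a \<noteq> c; b \<noteq> c\<rbrakk>
      \<Longrightarrow> card {x \<in> V. E x a \<and> E x b \<and> E x c} \<le> t"
begin

text \<open>Cauchy-Schwarz over \<open>w\<close> leaves the mass \<open>H\<close> times a sum over
  pairs \<open>u\<close>, \<open>u'\<close> and vertices \<open>w\<close> adjacent to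
  \<open>u\<close>, \<open>u'\<close> and \<open>v\<close>, lighter than both \<open>u\<close> and
  \<open>u'\<close>. Pairs with \<open>u = u'\<close> give at most \<open>H\<^sup>2\<close>; for
  distinct ones there are at most \<open>t\<close> such \<open>w\<close>, each of weight at most
  \<open>(\<alpha> u)\<^sup>2 * (\<alpha> u')\<^sup>2\<close>.\<close>

lemma link_sum_bound:
  fixes h :: "'a \<Rightarrow> real"
  assumes h: "\<And>x. h x \<ge> 0" and v: "v \<in> V"
  shows "(\<Sum>u\<in>V. \<Sum>w\<in>V. of_bool (E v u \<and> E v w \<and> E u w \<and> h u \<le> h v \<and> h w \<le> h u) * (h u * (h w)\<^sup>2))\<^sup>2
      \<le> (1 + t) * (\<Sum>x\<in>V. of_bool (E v x \<and> h x \<le> h v) * (h x)\<^sup>2) ^ 3" (is "?I\<^sup>2 \<le> _ * ?H ^ 3")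
proof -
  define \<alpha> where "\<alpha> x = of_bool (E v x \<and> h x \<le> h v) * h x" for x
  define B where "B u w \<longleftrightarrow> E u w \<and> h w \<le> h u" for u w
  have \<alpha>0: "\<alpha> x \<ge> 0" for x using h by (simp add: \<alpha>_def)
  have H: "?H = (\<Sum>x\<in>V. (\<alpha> x)\<^sup>2)"
    by (rule sum.cong) (auto simp: \<alpha>_def)
  define H where "H = (\<Sum>x\<in>V. (\<alpha> x)\<^sup>2)"
  have H0: "H \<ge> 0" unfolding H_def by (intro sum_nonneg) auto
  \<comment> \<open>The factor \<open>(h w)\<^sup>2\<close> is split: one \<open>\<alpha> w\<close>
    is the weight in Cauchy-Schwarz, the other stays in the inner sum.\<close>
  have I: "?I = (\<Sum>w\<in>V. \<alpha> w * (\<Sum>u\<in>V. of_bool (B u w) * (\<alpha> u * \<alpha> w)))"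
    unfolding sum_distrib_left
    apply (subst sum.swap)
    apply (intro sum.cong refl)
    apply (auto simp: \<alpha>_def B_def power2_eq_square)
    done
  have "?I\<^sup>2 \<le> H * (\<Sum>w\<in>V. (\<Sum>u\<in>V. of_bool (B u w) * (\<alpha> u * \<alpha> w))\<^sup>2)"
    unfolding H_def I by (rule Cauchy_Schwarz_ineq_sum)
  also have "(\<Sum>w\<in>V. (\<Sum>u\<in>V. of_bool (B u w) * (\<alpha> u * \<alpha> w))\<^sup>2)
      = (\<Sum>u\<in>V. \<Sum>u'\<in>V. \<Sum>w\<in>V. of_bool (B u w \<and> B u' w) * (\<alpha> u * \<alpha> u' * (\<alpha> w)\<^sup>2))"
  proof -
    have "(\<Sum>w\<in>V. (\<Sum>u\<in>V. of_bool (B u w) * (\<alpha> u * \<alpha> w))\<^sup>2)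
      = (\<Sum>w\<in>V. \<Sum>u\<in>V. \<Sum>u'\<in>V. of_bool (B u w \<and> B u' w) * (\<alpha> u * \<alpha> u' * (\<alpha> w)\<^sup>2))"
      unfolding power2_eq_square sum_product
      by (intro sum.cong refl) (auto simp: of_bool_conj)
    also have "\<dots> = (\<Sum>u\<in>V. \<Sum>w\<in>V. \<Sum>u'\<in>V. of_bool (B u w \<and> B u' w) * (\<alpha> u * \<alpha> u' * (\<alpha> w)\<^sup>2))"
      by (rule sum.swap)
    also have "\<dots> = (\<Sum>u\<in>V. \<Sum>u'\<in>V. \<Sum>w\<in>V. of_bool (B u w \<and> B u' w) * (\<alpha> u * \<alpha> u' * (\<alpha> w)\<^sup>2))"
      by (rule sum.cong[OF refl], rule sum.swap)
    finally show ?thesis .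
  qed
  also have "\<dots> \<le> (\<Sum>u\<in>V. \<Sum>u'\<in>V. (if u = u' then (\<alpha> u)\<^sup>2 * H else 0) + t * ((\<alpha> u)\<^sup>2 * (\<alpha> u')\<^sup>2))"
  proof (intro sum_mono)
    fix u u' assume u: "u \<in> V" "u' \<in> V"
    show "(\<Sum>w\<in>V. of_bool (B u w \<and> B u' w) * (\<alpha> u * \<alpha> u' * (\<alpha> w)\<^sup>2))
      \<le> (if u = u' then (\<alpha> u)\<^sup>2 * H else 0) + t * ((\<alpha> u)\<^sup>2 * (\<alpha> u')\<^sup>2)"
    proof (cases "u = u'")
      case True
      have "(\<Sum>w\<in>V. of_bool (B u w \<and> B u' w) * (\<alpha> u * \<alpha> u' * (\<alpha> w)\<^sup>2)) \<le> (\<Sum>w\<in>V. (\<alpha> u)\<^sup>2 * (\<alpha> w)\<^sup>2)"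
        by (intro sum_mono) (auto simp: True power2_eq_square)
      also have "\<dots> = (\<alpha> u)\<^sup>2 * H" by (simp add: H_def sum_distrib_left)
      also have "\<dots> \<le> (\<alpha> u)\<^sup>2 * H + t * ((\<alpha> u)\<^sup>2 * (\<alpha> u')\<^sup>2)" by simp
      finally show ?thesis using True by simp
    next
      case False
      have "(\<Sum>w\<in>V. of_bool (B u w \<and> B u' w) * (\<alpha> u * \<alpha> u' * (\<alpha> w)\<^sup>2))
        \<le> (\<Sum>w\<in>V. of_bool (E w v \<and> E w u \<and> E w u') * ((\<alpha> u)\<^sup>2 * (\<alpha> u')\<^sup>2))"
      proof (intro sum_mono)
        fix w
        show "of_bool (B u w \<and> B u' w) * (\<alpha> u * \<alpha> u' * (\<alpha> w)\<^sup>2)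
          \<le> of_bool (E w v \<and> E w u \<and> E w u') * ((\<alpha> u)\<^sup>2 * (\<alpha> u')\<^sup>2)"
        proof (cases "\<alpha> u = 0 \<or> \<alpha> u' = 0 \<or> \<alpha> w = 0 \<or> \<not> (B u w \<and> B u' w)")
          case False
          hence *: "E w v" "E w u" "E w u'" "\<alpha> w \<le> \<alpha> u" "\<alpha> w \<le> \<alpha> u'"
            using E_sym by (auto simp: \<alpha>_def B_def split: if_splits)
          \<comment> \<open>As \<open>w\<close> is the lightest, its mass is traded for that of
            \<open>u\<close> and \<open>u'\<close>; the summand no longer depends on
            \<open>w\<close>, which is then merely counted.\<close>
          have "(\<alpha> w)\<^sup>2 \<le> \<alpha> u * \<alpha> u'"
            unfolding power2_eq_square by (intro mult_mono * \<alpha>0)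
          hence "\<alpha> u * \<alpha> u' * (\<alpha> w)\<^sup>2 \<le> \<alpha> u * \<alpha> u' * (\<alpha> u * \<alpha> u')"
            by (intro mult_left_mono) (auto simp: \<alpha>0)
          thus ?thesis using * False by (simp add: power2_eq_square mult_ac)
        qed auto
      qed
      also have "\<dots> = real (card {w\<in>V. E w v \<and> E w u \<and> E w u'}) * ((\<alpha> u)\<^sup>2 * (\<alpha> u')\<^sup>2)"
        by (simp add: sum_of_bool_eq_card[OF finV] flip: sum_distrib_right)
      also have "\<dots> \<le> t * ((\<alpha> u)\<^sup>2 * (\<alpha> u')\<^sup>2)"
      proof (cases "\<alpha> u = 0 \<or> \<alpha> u' = 0")
        case nz: False
        hence "E v u" "E v u'" by (auto simp: \<alpha>_def split: if_splits)
        hence "card {w\<in>V. E w v \<and> E w u \<and> E w u'} \<le> t"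
          using u v False E_irrefl by (intro common) auto
        thus ?thesis by (intro mult_right_mono) auto
      qed auto
      finally show ?thesis using False by simp
    qed
  qed
  also have "\<dots> = (\<Sum>u\<in>V. (\<alpha> u)\<^sup>2 * H) + t * (\<Sum>u\<in>V. \<Sum>u'\<in>V. (\<alpha> u)\<^sup>2 * (\<alpha> u')\<^sup>2)"
    by (simp add: sum.distrib sum_distrib_left finV)
  also have "\<dots> = (1 + t) * H\<^sup>2"
  proof -
    have "(\<Sum>u\<in>V. \<Sum>u'\<in>V. (\<alpha> u)\<^sup>2 * (\<alpha> u')\<^sup>2) = H\<^sup>2"
      by (simp add: H_def power2_eq_square[of "sum _ _"] sum_product)
    moreover have "(\<Sum>u\<in>V. (\<alpha> u)\<^sup>2 * H) = H\<^sup>2"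
      by (simp add: power2_eq_square[of H] flip: sum_distrib_right) (simp add: H_def)
    ultimately show ?thesis by (simp add: algebra_simps)
  qed
  finally have "?I\<^sup>2 \<le> H * ((1 + t) * H\<^sup>2)"
    using H0 by (simp add: mult_left_mono)
  also have "\<dots> = (1 + t) * H ^ 3" by (simp add: power2_eq_square power3_eq_cube)
  finally show ?thesis by (simp add: H H_def)
qed

text \<open>Expanding the cube and summing over \<open>v\<close> first counts common neighbours of
  \<open>x\<close>, \<open>y\<close>, \<open>z\<close>: at most \<open>t\<close> if these are
  distinct. If two of them coincide, \<open>deg\<close> absorbs the sum over \<open>v\<close>, and
  each of the three coincidences costs at most 1.\<close>

lemma sum_link_mass_cubed:
  fixes h :: "'a \<Rightarrow> real"
  assumes h: "\<And>x. h x \<ge> 0" and norm: "(\<Sum>x\<in>V. (h x)\<^sup>2) \<le> 1"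
  shows "(\<Sum>v\<in>V. (\<Sum>x\<in>V. of_bool (E v x \<and> h x \<le> h v) * (h x)\<^sup>2) ^ 3) \<le> t + 3"
proof -
  define C where "C v x \<longleftrightarrow> E v x \<and> h x \<le> h v" for v x
  define g where "g x = (h x)\<^sup>2" for x
  define S where "S = (\<Sum>x\<in>V. g x)"
  have g0: "g x \<ge> 0" for x by (simp add: g_def)
  have S: "0 \<le> S" "S \<le> 1" using norm sum_nonneg[of V g] g0 by (simp_all add: S_def g_def)
  \<comment> \<open>Every \<open>v\<close> counted here is at least as heavy as \<open>x\<close>, so
    it contributes at least \<open>g x\<close> to the total mass.\<close>
  have deg: "(\<Sum>v\<in>V. of_bool (C v x)) * g x \<le> 1" if "x \<in> V" for x
  proof -
    have "(\<Sum>v\<in>V. of_bool (C v x)) * g x \<le> (\<Sum>v\<in>V. g v)"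
      unfolding sum_distrib_right using h
      by (intro sum_mono) (auto simp: C_def g_def power_mono)
    thus ?thesis using S by (simp add: S_def)
  qed
  have cube: "(\<Sum>x\<in>V. f x) ^ 3 = (\<Sum>x\<in>V. \<Sum>y\<in>V. \<Sum>z\<in>V. f x * f y * f z)" for f :: "'a \<Rightarrow> real"
  proof -
    have "(\<Sum>x\<in>V. f x) ^ 3 = (\<Sum>x\<in>V. \<Sum>y\<in>V. f x * f y * (\<Sum>z\<in>V. f z))"
      unfolding power3_eq_cube sum_product[of f V f V] by (simp add: sum_distrib_right)
    thus ?thesis by (simp add: sum_distrib_left)
  qed
  have "(\<Sum>v\<in>V. (\<Sum>x\<in>V. of_bool (C v x) * g x) ^ 3)
    = (\<Sum>v\<in>V. \<Sum>x\<in>V. \<Sum>y\<in>V. \<Sum>z\<in>V. of_bool (C v x \<and> C v y \<and> C v z) * (g x * g y * g z))"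
    unfolding cube by (intro sum.cong refl) (simp add: of_bool_conj)
  also have "\<dots> = (\<Sum>x\<in>V. \<Sum>v\<in>V. \<Sum>y\<in>V. \<Sum>z\<in>V. of_bool (C v x \<and> C v y \<and> C v z) * (g x * g y * g z))"
    by (rule sum.swap)
  also have "\<dots> = (\<Sum>x\<in>V. \<Sum>y\<in>V. \<Sum>v\<in>V. \<Sum>z\<in>V. of_bool (C v x \<and> C v y \<and> C v z) * (g x * g y * g z))"
    by (rule sum.cong[OF refl], rule sum.swap)
  also have "\<dots> = (\<Sum>x\<in>V. \<Sum>y\<in>V. \<Sum>z\<in>V. \<Sum>v\<in>V. of_bool (C v x \<and> C v y \<and> C v z) * (g x * g y * g z))"
    by (rule sum.cong[OF refl], rule sum.cong[OF refl], rule sum.swap)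
  also have "\<dots> \<le> (\<Sum>x\<in>V. \<Sum>y\<in>V. \<Sum>z\<in>V. t * (g x * g y * g z) + ((if x = y then g x * g z else 0)
      + (if x = z then g x * g y else 0) + (if y = z then g x * g y else 0)))"
  proof (intro sum_mono)
    fix x y z assume xyz: "x \<in> V" "y \<in> V" "z \<in> V"
    \<comment> \<open>For a coincidence, \<open>p\<close> is the repeated variable: its mass pays
      for the number of \<open>v\<close>, and the product \<open>a * b\<close> of the other two
      masses remains.\<close>
    have deg': "(\<Sum>v\<in>V. of_bool (C v x \<and> C v y \<and> C v z)) * (g x * g y * g z) \<le> a * b"
      if "p \<in> V" "g x * g y * g z = g p * (a * b)" "\<And>v. C v x \<and> C v y \<and> C v z \<Longrightarrow> C v p" "a \<ge> 0" "b \<ge> 0"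
      for p a b
    proof -
      have "(\<Sum>v\<in>V. of_bool (C v x \<and> C v y \<and> C v z)) * (g x * g y * g z)
        \<le> (\<Sum>v\<in>V. of_bool (C v p)) * g p * (a * b)"
        unfolding that(2) mult.assoc[symmetric]
        using that g0 by (intro mult_right_mono sum_mono) auto
      also have "\<dots> \<le> 1 * (a * b)" using deg[OF that(1)] that by (intro mult_right_mono) auto
      finally show ?thesis by simp
    qed
    have "(\<Sum>v\<in>V. of_bool (C v x \<and> C v y \<and> C v z)) * (g x * g y * g z) \<le> t * (g x * g y * g z) + ((if x = y then g x * g z else 0)
      + (if x = z then g x * g y else 0) + (if y = z then g x * g y else 0))"
    proof (cases "x \<noteq> y \<and> x \<noteq> z \<and> y \<noteq> z")
      case True
      have "(\<Sum>v\<in>V. of_bool (C v x \<and> C v y \<and> C v z)) \<le> (\<Sum>v\<in>V. of_bool (E v x \<and> E v y \<and> E v z) :: real)"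
        by (intro sum_mono) (auto simp: C_def)
      also have "\<dots> = real (card {v\<in>V. E v x \<and> E v y \<and> E v z})"
        by (rule sum_of_bool_eq_card[OF finV])
      also have "\<dots> \<le> t" using common[of x y z] True xyz by simp
      finally have "(\<Sum>v\<in>V. of_bool (C v x \<and> C v y \<and> C v z)) * (g x * g y * g z) \<le> t * (g x * g y * g z)"
        using g0 by (intro mult_right_mono) auto
      thus ?thesis using True by simp
    next
      case False
      have nn: "0 \<le> t * (g x * g y * g z)" "0 \<le> (if x = y then g x * g z else 0)"
        "0 \<le> (if x = z then g x * g y else 0)" "0 \<le> (if y = z then g x * g y else 0)" using g0 by auto
      from False consider "x = y" | "x = z" | "y = z" by auto
      thus ?thesis
      proof cases
        case 1
        have "(\<Sum>v\<in>V. of_bool (C v x \<and> C v y \<and> C v z)) * (g x * g y * g z) \<le> g x * g z"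
          by (rule deg'[of x]) (use 1 g0 xyz in auto)
        moreover have "(if x = y then g x * g z else 0) = g x * g z" using 1 by simp
        ultimately show ?thesis using nn by linarith
      next
        case 2
        have "(\<Sum>v\<in>V. of_bool (C v x \<and> C v y \<and> C v z)) * (g x * g y * g z) \<le> g x * g y"
          by (rule deg'[of x]) (use 2 g0 xyz in auto)
        moreover have "(if x = z then g x * g y else 0) = g x * g y" using 2 by simp
        ultimately show ?thesis using nn by linarith
      next
        case 3
        have "(\<Sum>v\<in>V. of_bool (C v x \<and> C v y \<and> C v z)) * (g x * g y * g z) \<le> g x * g y"
          by (rule deg'[of y]) (use 3 g0 xyz in auto)
        moreover have "(if y = z then g x * g y else 0) = g x * g y" using 3 by simp
        ultimately show ?thesis using nn by linarith
      qed
    qed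
    thus "(\<Sum>v\<in>V. of_bool (C v x \<and> C v y \<and> C v z) * (g x * g y * g z)) \<le> t * (g x * g y * g z) + ((if x = y then g x * g z else 0)
      + (if x = z then g x * g y else 0) + (if y = z then g x * g y else 0))"
      by (simp add: sum_distrib_right)
  qed
  also have "\<dots> = t * S ^ 3 + 3 * S\<^sup>2"
  proof -
    have e1: "(\<Sum>x\<in>V. \<Sum>y\<in>V. \<Sum>z\<in>V. if x = y then g x * g z else 0) = S\<^sup>2"
    proof -
      have "(\<Sum>y\<in>V. \<Sum>z\<in>V. if x = y then g x * g z else 0) = g x * S" if "x \<in> V" for x
      proof -
        have "(\<Sum>y\<in>V. \<Sum>z\<in>V. if x = y then g x * g z else 0) = (\<Sum>y\<in>V. if x = y then (\<Sum>z\<in>V. g x * g z) else 0)"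
          by (intro sum.cong) auto
        thus ?thesis using that finV by (simp add: S_def sum_distrib_left)
      qed
      thus ?thesis by (simp add: power2_eq_square S_def sum_distrib_right)
    qed
    have e2: "(\<Sum>x\<in>V. \<Sum>y\<in>V. \<Sum>z\<in>V. if x = z then g x * g y else 0) = S\<^sup>2"
      "(\<Sum>x\<in>V. \<Sum>y\<in>V. \<Sum>z\<in>V. if y = z then g x * g y else 0) = S\<^sup>2"
      using finV by (simp_all add: S_def power2_eq_square sum_product)
    have e3: "(\<Sum>x\<in>V. \<Sum>y\<in>V. \<Sum>z\<in>V. t * (g x * g y * g z)) = t * S ^ 3"
      unfolding S_def cube by (simp add: sum_distrib_left)
    show ?thesis by (simp add: sum.distrib e1 e2 e3)
  qed
  also have "\<dots> \<le> real t * 1 + 3 * 1"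
    using S by (intro add_mono mult_left_mono power_le_one) auto
  finally show ?thesis unfolding C_def g_def by simp
qed

text \<open>\<open>I v\<close> is what remains at the heaviest vertex \<open>v\<close> once
  \<open>z\<close> is summed out. Cauchy-Schwarz over \<open>v\<close> combines the two preceding
  bounds on \<open>(I v)\<^sup>2\<close> and on the sum of \<open>H v ^ 3\<close>.\<close>

theorem clique_sum_bound:
  fixes h :: "'a \<Rightarrow> real"
  assumes h: "\<And>x. h x \<ge> 0" and norm: "(\<Sum>x\<in>V. (h x)\<^sup>2) \<le> 1"
  shows "quad_sum V (\<lambda>v u w z. of_bool (E v u \<and> E v w \<and> E v z \<and> E u w \<and> E u z \<and> E w z) * (h v * h u * h w * h z))
    \<le> 24 * (t * (t + 2))" (is "quad_sum V ?P \<le> _")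
proof -
  define I where "I v = (\<Sum>u\<in>V. \<Sum>w\<in>V. of_bool (E v u \<and> E v w \<and> E u w \<and> h u \<le> h v \<and> h w \<le> h u) * (h u * (h w)\<^sup>2))" for v
  define H where "H v = (\<Sum>x\<in>V. of_bool (E v x \<and> h x \<le> h v) * (h x)\<^sup>2)" for v
  have "quad_sum V ?P \<le> 24 * quad_sum V (\<lambda>v u w z. of_bool (h u \<le> h v \<and> h w \<le> h u \<and> h z \<le> h w) * ?P v u w z)"
    by (rule quad_sum_le_ordered) (use h E_sym in \<open>auto simp: of_bool_def\<close>)
  also have "quad_sum V (\<lambda>v u w z. of_bool (h u \<le> h v \<and> h w \<le> h u \<and> h z \<le> h w) * ?P v u w z) \<le> t * (\<Sum>v\<in>V. h v * I v)"
    unfolding quad_sum_def I_def sum_distrib_left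
  proof (intro sum_mono)
    fix v u w assume vuw: "v \<in> V" "u \<in> V" "w \<in> V"
    show "(\<Sum>z\<in>V. of_bool (h u \<le> h v \<and> h w \<le> h u \<and> h z \<le> h w) * ?P v u w z)
     \<le> t * (h v * (of_bool (E v u \<and> E v w \<and> E u w \<and> h u \<le> h v \<and> h w \<le> h u) * (h u * (h w)\<^sup>2)))"
    proof (cases "E v u \<and> E v w \<and> E u w \<and> h u \<le> h v \<and> h w \<le> h u")
      case True
      have "(\<Sum>z\<in>V. of_bool (h u \<le> h v \<and> h w \<le> h u \<and> h z \<le> h w) * ?P v u w z)
        \<le> (\<Sum>z\<in>V. of_bool (E z v \<and> E z u \<and> E z w) * (h v * h u * h w * h w))"
        using h E_sym by (intro sum_mono) (auto simp: mult_left_mono)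
      also have "\<dots> = real (card {z\<in>V. E z v \<and> E z u \<and> E z w}) * (h v * h u * h w * h w)"
        by (simp add: sum_of_bool_eq_card[OF finV] flip: sum_distrib_right)
      also have "\<dots> \<le> t * (h v * h u * h w * h w)"
      proof -
        have "card {z\<in>V. E z v \<and> E z u \<and> E z w} \<le> t"
          using True vuw E_irrefl by (intro common) auto
        thus ?thesis using h by (intro mult_right_mono) auto
      qed
      finally show ?thesis using True by (simp add: power2_eq_square mult_ac)
    qed (auto intro!: sum_nonpos)
  qed
  also have "(\<Sum>v\<in>V. h v * I v) \<le> real t + 2"
  proof (rule power2_le_imp_le)
    have "(\<Sum>v\<in>V. h v * I v)\<^sup>2 \<le> (\<Sum>v\<in>V. (h v)\<^sup>2) * (\<Sum>v\<in>V. (I v)\<^sup>2)"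
      by (rule Cauchy_Schwarz_ineq_sum)
    also have "\<dots> \<le> 1 * (\<Sum>v\<in>V. (I v)\<^sup>2)"
      using norm by (intro mult_right_mono) (auto intro: sum_nonneg)
    also have "\<dots> \<le> 1 * (\<Sum>v\<in>V. (1 + t) * H v ^ 3)"
      unfolding I_def H_def by (intro mult_left_mono sum_mono link_sum_bound h) auto
    also have "\<dots> = (1 + t) * (\<Sum>v\<in>V. H v ^ 3)" by (simp add: sum_distrib_left)
    also have "\<dots> \<le> (1 + real t) * (real t + 3)"
      using sum_link_mass_cubed[OF h norm] by (simp add: mult_left_mono H_def)
    also have "\<dots> \<le> (real t + 2)\<^sup>2" by (simp add: power2_eq_square algebra_simps)
    finally show "(\<Sum>v\<in>V. h v * I v)\<^sup>2 \<le> (real t + 2)\<^sup>2" by simp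
  qed simp
  finally have "quad_sum V ?P \<le> 24 * (real t * (real t + 2))" by (simp add: mult_left_mono)
  thus ?thesis by (simp add: ring_distribs)
qed

end

section \<open>Polarization of quartic forms\<close>

lemma quad_sum_cong:
  assumes "\<And>a b c d. \<lbrakk>a \<in> V; b \<in> V; c \<in> V; d \<in> V\<rbrakk> \<Longrightarrow> f a b c d = g a b c d"
  shows "quad_sum V f = quad_sum V g"
  unfolding quad_sum_def by (intro sum.cong refl assms)

lemma quad_sum_sum: "quad_sum V (\<lambda>a b c d. \<Sum>s\<in>S. g s a b c d) = (\<Sum>s\<in>S. quad_sum V (g s))"
proof (induction S rule: infinite_finite_induct)
  case (insert s S)
  then show ?case by (simp add: quad_sum_add)
qed (simp_all add: quad_sum_def)

lemma quad_sum_cmult: "quad_sum V (\<lambda>a b c d. r * g a b c d) = r * quad_sum V g"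
  unfolding quad_sum_def by (simp add: sum_distrib_left)

text \<open>Adjacent transpositions as operators on kernels: words in them reach all 24
  permutations, and their invariance can be applied by rewriting.\<close>

definition swp12 :: "('a \<Rightarrow> 'a \<Rightarrow> 'a \<Rightarrow> 'a \<Rightarrow> real) \<Rightarrow> 'a \<Rightarrow> 'a \<Rightarrow> 'a \<Rightarrow> 'a \<Rightarrow> real" where
  "swp12 g = (\<lambda>a b c d. g b a c d)"

definition swp23 :: "('a \<Rightarrow> 'a \<Rightarrow> 'a \<Rightarrow> 'a \<Rightarrow> real) \<Rightarrow> 'a \<Rightarrow> 'a \<Rightarrow> 'a \<Rightarrow> 'a \<Rightarrow> real" where
  "swp23 g = (\<lambda>a b c d. g a c b d)"

definition swp34 :: "('a \<Rightarrow> 'a \<Rightarrow> 'a \<Rightarrow> 'a \<Rightarrow> real) \<Rightarrow> 'a \<Rightarrow> 'a \<Rightarrow> 'a \<Rightarrow> 'a \<Rightarrow> real" where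
  "swp34 g = (\<lambda>a b c d. g a b d c)"

lemma quad_sum_swp:
  "quad_sum V (swp12 g) = quad_sum V g" "quad_sum V (swp23 g) = quad_sum V g"
  "quad_sum V (swp34 g) = quad_sum V g"
  unfolding swp12_def swp23_def swp34_def
  by (rule quad_sum_swap12 quad_sum_swap23 quad_sum_swap34)+

text \<open>The symmetrization is the multilinear part of the quartic form, which polarization
  recovers from values of the form and which vanishes with them.\<close>

lemma quartic_form_zero_imp_symmetrization_zero:
  fixes T :: "'a \<Rightarrow> 'a \<Rightarrow> 'a \<Rightarrow> 'a \<Rightarrow> real"
  assumes fin: "finite V"
    and zero: "\<And>x. quad_sum V (\<lambda>a b c d. T a b c d * (x a * x b * x c * x d)) = 0"
    and V: "a \<in> V" "b \<in> V" "c \<in> V" "d \<in> V"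
  shows "T a b c d
      + T a b d c
      + T a c b d
      + T a c d b
      + T a d b c
      + T a d c b
      + T b a c d
      + T b a d c
      + T b c a d
      + T b c d a
      + T b d a c
      + T b d c a
      + T c a b d
      + T c a d b
      + T c b a d
      + T c b d a
      + T c d a b
      + T c d b a
      + T d a b c
      + T d a c b
      + T d b a c
      + T d b c a
      + T d c a b
      + T d c b a = 0"
proof -
  define Q where "Q x y z w = quad_sum V (\<lambda>a b c d. T a b c d * (x a * y b * z c * w d))" for x y z w
  have add: "Q (\<lambda>a. x a + x' a) y z w = Q x y z w + Q x' y z w"
    "Q x (\<lambda>a. y a + y' a) z w = Q x y z w + Q x y' z w"
    "Q x y (\<lambda>a. z a + z' a) w = Q x y z w + Q x y z' w"
    "Q x y z (\<lambda>a. w a + w' a) = Q x y z w + Q x y z w'" for x x' y y' z z' w w'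
    unfolding Q_def by (simp_all add: ring_distribs flip: quad_sum_add)
  have neg: "Q (\<lambda>a. - x a) y z w = - Q x y z w" "Q x (\<lambda>a. - y a) z w = - Q x y z w"
    "Q x y (\<lambda>a. - z a) w = - Q x y z w" "Q x y z (\<lambda>a. - w a) = - Q x y z w" for x y z w
    using quad_sum_cmult[of V "-1"] unfolding Q_def by simp_all
  have Q0: "Q x x x x = 0" for x
    unfolding Q_def by (rule zero)
  \<comment> \<open>Adding the values at \<open>x + y\<close> and \<open>x - y\<close> cancels the
    odd terms and leaves those of bidegree (2, 2).\<close>
  have Q22: "Q x x y y + Q x y x y + Q x y y x + Q y x x y + Q y x y x + Q y y x x = 0" for x y
    using Q0[of "\<lambda>a. x a + y a"] Q0[of "\<lambda>a. x a + - y a"] Q0[of x] Q0[of y]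
    unfolding add neg by linarith
  \<comment> \<open>The form in \<open>Q22\<close> is quadratic in each argument. Taking its mixed
    difference in both arguments leaves the terms in which each of the four vectors occurs
    once.\<close>
  have pol: "Q x x' y y'
      + Q x x' y' y
      + Q x y x' y'
      + Q x y y' x'
      + Q x y' x' y
      + Q x y' y x'
      + Q x' x y y'
      + Q x' x y' y
      + Q x' y x y'
      + Q x' y y' x
      + Q x' y' x y
      + Q x' y' y x
      + Q y x x' y'
      + Q y x y' x'
      + Q y x' x y'
      + Q y x' y' x
      + Q y y' x x'
      + Q y y' x' x
      + Q y' x x' y
      + Q y' x y x'
      + Q y' x' x y
      + Q y' x' y x
      + Q y' y x x'
      + Q y' y x' x = 0" for x x' y y'
    using Q22[of "\<lambda>a. x a + x' a" "\<lambda>a. y a + y' a"]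
      Q22[of "\<lambda>a. x a + x' a" y] Q22[of "\<lambda>a. x a + x' a" y'] Q22[of x "\<lambda>a. y a + y' a"]
      Q22[of x' "\<lambda>a. y a + y' a"] Q22[of x y] Q22[of x y'] Q22[of x' y] Q22[of x' y']
    unfolding add by linarith
  define \<delta> :: "'a \<Rightarrow> 'a \<Rightarrow> real" where "\<delta> i j = of_bool (j = i)" for i j
  have Q\<delta>: "Q (\<delta> i) (\<delta> j) (\<delta> k) (\<delta> l) = T i j k l" if "i \<in> V" "j \<in> V" "k \<in> V" "l \<in> V" for i j k l
  proof -
    have pick: "(\<Sum>e\<in>V. \<delta> i e * f e) = f i" if "i \<in> V" for i and f :: "'a \<Rightarrow> real"
      using that fin by (simp add: \<delta>_def of_bool_def if_distrib[of "\<lambda>x. x * _"] sum.delta cong: if_cong)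
    have "Q (\<delta> i) (\<delta> j) (\<delta> k) (\<delta> l) = (\<Sum>a\<in>V. \<delta> i a * (\<Sum>b\<in>V. \<delta> j b * (\<Sum>c\<in>V. \<delta> k c * (\<Sum>d\<in>V. \<delta> l d * T a b c d))))"
      unfolding Q_def quad_sum_def by (simp add: sum_distrib_left mult_ac)
    thus ?thesis using that by (simp add: pick)
  qed
  show ?thesis
    using pol[of "\<delta> a" "\<delta> b" "\<delta> c" "\<delta> d"] by (simp only: Q\<delta> V)
qed

text \<open>Permuting the arguments of \<open>T\<close> does not change its pairing with a symmetric
  \<open>X\<close>, so 24 times the pairing is that of the symmetrization of \<open>T\<close>. With
  \<open>T\<close> the difference of two representations of one polynomial, both pair equally with
  \<open>X\<close>.\<close>

lemma symmetric_pairing_zero: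
  fixes T X :: "'a \<Rightarrow> 'a \<Rightarrow> 'a \<Rightarrow> 'a \<Rightarrow> real"
  assumes fin: "finite V"
    and zero: "\<And>x. quad_sum V (\<lambda>a b c d. T a b c d * (x a * x b * x c * x d)) = 0"
    and sym: "\<And>a b c d. X a b c d = X b a c d" "\<And>a b c d. X a b c d = X a c b d"
      "\<And>a b c d. X a b c d = X a b d c"
  shows "quad_sum V (\<lambda>a b c d. T a b c d * X a b c d) = 0"
proof -
  define P where "P = (\<lambda>a b c d. T a b c d * X a b c d)"
  have swp: "swp12 (\<lambda>a b c d. g a b c d * X a b c d) = (\<lambda>a b c d. swp12 g a b c d * X a b c d)"
    "swp23 (\<lambda>a b c d. g a b c d * X a b c d) = (\<lambda>a b c d. swp23 g a b c d * X a b c d)"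
    "swp34 (\<lambda>a b c d. g a b c d * X a b c d) = (\<lambda>a b c d. swp34 g a b c d * X a b c d)" for g
    unfolding swp12_def swp23_def swp34_def using sym by auto
  have "0 = quad_sum V (\<lambda>a b c d. 0)" by (simp add: quad_sum_def)
  also have "\<dots> = quad_sum V (\<lambda>a b c d. (P) a b c d
      + (swp34 P) a b c d
      + (swp34 (swp23 P)) a b c d
      + (swp34 (swp23 (swp12 P))) a b c d
      + (swp23 P) a b c d
      + (swp23 (swp34 P)) a b c d
      + (swp23 (swp34 (swp23 P))) a b c d
      + (swp23 (swp34 (swp23 (swp12 P)))) a b c d
      + (swp23 (swp12 P)) a b c d
      + (swp23 (swp12 (swp34 P))) a b c d
      + (swp23 (swp12 (swp34 (swp23 P)))) a b c d
      + (swp23 (swp12 (swp34 (swp23 (swp12 P))))) a b c d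
      + (swp12 P) a b c d
      + (swp12 (swp34 P)) a b c d
      + (swp12 (swp34 (swp23 P))) a b c d
      + (swp12 (swp34 (swp23 (swp12 P)))) a b c d
      + (swp12 (swp23 P)) a b c d
      + (swp12 (swp23 (swp34 P))) a b c d
      + (swp12 (swp23 (swp34 (swp23 P)))) a b c d
      + (swp12 (swp23 (swp34 (swp23 (swp12 P))))) a b c d
      + (swp12 (swp23 (swp12 P))) a b c d
      + (swp12 (swp23 (swp12 (swp34 P)))) a b c d
      + (swp12 (swp23 (swp12 (swp34 (swp23 P))))) a b c d
      + (swp12 (swp23 (swp12 (swp34 (swp23 (swp12 P)))))) a b c d)"
  proof (rule quad_sum_cong)
    fix a b c d assume V: "a \<in> V" "b \<in> V" "c \<in> V" "d \<in> V"
    show "0 = (P) a b c d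
      + (swp34 P) a b c d
      + (swp34 (swp23 P)) a b c d
      + (swp34 (swp23 (swp12 P))) a b c d
      + (swp23 P) a b c d
      + (swp23 (swp34 P)) a b c d
      + (swp23 (swp34 (swp23 P))) a b c d
      + (swp23 (swp34 (swp23 (swp12 P)))) a b c d
      + (swp23 (swp12 P)) a b c d
      + (swp23 (swp12 (swp34 P))) a b c d
      + (swp23 (swp12 (swp34 (swp23 P)))) a b c d
      + (swp23 (swp12 (swp34 (swp23 (swp12 P))))) a b c d
      + (swp12 P) a b c d
      + (swp12 (swp34 P)) a b c d
      + (swp12 (swp34 (swp23 P))) a b c d
      + (swp12 (swp34 (swp23 (swp12 P)))) a b c d
      + (swp12 (swp23 P)) a b c d
      + (swp12 (swp23 (swp34 P))) a b c d
      + (swp12 (swp23 (swp34 (swp23 P)))) a b c d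
      + (swp12 (swp23 (swp34 (swp23 (swp12 P))))) a b c d
      + (swp12 (swp23 (swp12 P))) a b c d
      + (swp12 (swp23 (swp12 (swp34 P)))) a b c d
      + (swp12 (swp23 (swp12 (swp34 (swp23 P))))) a b c d
      + (swp12 (swp23 (swp12 (swp34 (swp23 (swp12 P)))))) a b c d"
      unfolding P_def swp distrib_right[symmetric]
      unfolding swp12_def swp23_def swp34_def
      using quartic_form_zero_imp_symmetrization_zero[OF fin zero V]
      by (simp add: add_ac)
  qed
  also have "\<dots> = 24 * quad_sum V P"
    unfolding quad_sum_add quad_sum_swp by simp
  finally show ?thesis by (simp add: P_def)
qed

section \<open>Walsh characters\<close>

lemma xor_less_power2: "(a::nat) < 2 ^ k \<Longrightarrow> b < 2 ^ k \<Longrightarrow> a \<oplus> b < 2 ^ k"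
  by (metis take_bit_nat_eq_self_iff take_bit_xor)

lemma xor_left_self [simp]: "(a::nat) \<oplus> (a \<oplus> b) = b"
  by (simp flip: xor.assoc)

lemma xor_right_self [simp]: "(b::nat) \<oplus> a \<oplus> a = b"
  by (simp add: xor.assoc)

lemma xor_eq_0_iff [simp]: "(a::nat) \<oplus> b = 0 \<longleftrightarrow> a = b"
  by (metis xor_left_self xor.right_neutral xor_self_eq)

lemma xor_eq_iff: "(a::nat) \<oplus> b = c \<longleftrightarrow> b = a \<oplus> c"
  by auto

lemma xor_eq_self_iff [simp]: "(a::nat) = a \<oplus> b \<longleftrightarrow> b = 0" "(a::nat) \<oplus> b = a \<longleftrightarrow> b = 0"
  by (metis xor_left_self xor.right_neutral xor_self_eq)+

lemma sum_xor:
  assumes "a < 2 ^ k"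
  shows "(\<Sum>x<2 ^ k. f (a \<oplus> x)) = (\<Sum>x::nat<2 ^ k. f x)"
  by (rule sum.reindex_bij_witness[of _ "\<lambda>x. a \<oplus> x" "\<lambda>x. a \<oplus> x"]) (use assms xor_less_power2 in auto)

text \<open>The sign \<open>(-1)\<close> to the inner product over the field with two elements of
  the lowest \<open>k\<close> bits of \<open>c\<close> and \<open>x\<close>.\<close>

definition walsh :: "nat \<Rightarrow> nat \<Rightarrow> nat \<Rightarrow> real" where
  "walsh k c x = (\<Prod>i<k. if bit c i \<and> bit x i then - 1 else 1)"

lemma walsh_commute: "walsh k c x = walsh k x c"
  unfolding walsh_def by (simp add: conj_commute)

lemma walsh_xor: "walsh k c (x \<oplus> y) = walsh k c x * walsh k c y"
  unfolding walsh_def prod.distrib[symmetric] by (rule prod.cong) (auto simp: bit_xor_iff)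

lemma walsh_0 [simp]: "walsh k c 0 = 1" "walsh k 0 x = 1"
  by (simp_all add: walsh_def)

lemma walsh_square [simp]: "walsh k c x * walsh k c x = 1"
  by (metis walsh_xor walsh_0(1) xor_self_eq)

lemma walsh_cases: "walsh k c x = 1 \<or> walsh k c x = - 1"
  using walsh_square[of k c x] by (simp only: square_eq_1_iff)

lemma walsh_ge: "walsh k c x \<ge> - 1"
  using walsh_cases[of k c x] by auto

text \<open>If bit \<open>i\<close> of \<open>c\<close> is set, translation by \<open>2 ^ i\<close>
  permutes the summands and flips all signs.\<close>

lemma sum_walsh_eq_0:
  assumes "c < 2 ^ k" "c \<noteq> 0"
  shows "(\<Sum>x<2 ^ k. walsh k c x) = 0"
proof -
  obtain i where i: "bit c i" using assms(2) by (metis bit_eq_iff bit_0_eq bot_apply bot_bool_def)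
  have ik: "i < k"
    using i assms(1) by (metis bit_take_bit_iff take_bit_nat_eq_self_iff)
  have m: "walsh k c (2 ^ i) = - 1"
  proof -
    have "walsh k c (2 ^ i) = (\<Prod>j<k. if j = i then - 1 else 1)"
      unfolding walsh_def by (rule prod.cong) (auto simp: bit_exp_iff i)
    thus ?thesis using ik by simp
  qed
  have "(\<Sum>x<2 ^ k. walsh k c x) = (\<Sum>x<2 ^ k. walsh k c (2 ^ i \<oplus> x))"
    by (rule sum_xor[symmetric]) (use ik in simp)
  also have "\<dots> = - (\<Sum>x<2 ^ k. walsh k c x)"
    by (simp add: walsh_xor m sum_negf)
  finally show ?thesis by simp
qed

text \<open>Fourier inversion: after exchanging the sums, orthogonality of characters leaves only
  \<open>u = t\<close>.\<close>

lemma walsh_inversion: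
  assumes t: "t < 2 ^ k"
  shows "(\<Sum>c<2 ^ k. (\<Sum>u<2 ^ k. g u * walsh k c u) * walsh k c t) = 2 ^ k * g t"
proof -
  have "(\<Sum>c<2 ^ k. (\<Sum>u<2 ^ k. g u * walsh k c u) * walsh k c t)
    = (\<Sum>c<2 ^ k. \<Sum>u<2 ^ k. g u * walsh k (u \<oplus> t) c)"
    by (intro sum.cong refl) (simp add: sum_distrib_right walsh_commute[of k "_ \<oplus> _"] walsh_xor mult.assoc)
  also have "\<dots> = (\<Sum>u<2 ^ k. g u * (\<Sum>c<2 ^ k. walsh k (u \<oplus> t) c))"
    by (subst sum.swap) (simp add: sum_distrib_left)
  also have "\<dots> = (\<Sum>u<2 ^ k. if u = t then 2 ^ k * g u else 0)"
    by (intro sum.cong refl) (auto simp: sum_walsh_eq_0 xor_less_power2 t)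
  finally show ?thesis using t by simp
qed

section \<open>Duality against positive semidefinite tensors\<close>

text \<open>Scaling reduces to unit vectors. Their coordinates are at most 1 in absolute value, so
  the sum of the absolute entries of \<open>M\<close> bounds the form and the supremum is a genuine
  one.\<close>

lemma quad_form_le_sup_sphere:
  fixes M :: "'i \<Rightarrow> 'i \<Rightarrow> real"
  assumes fin: "finite I"
  shows "quad_form I M z \<le> (SUP z\<in>{z. L2_set z I = 1}. quad_form I M z) * (\<Sum>a\<in>I. (z a)\<^sup>2)"
proof (cases "L2_set z I = 0")
  case True
  hence "\<And>a. a \<in> I \<Longrightarrow> z a = 0" using L2_set_eq_0_iff[OF fin, of z] by auto
  thus ?thesis by (simp add: quad_form_def)
next
  case False
  define r where "r = L2_set z I"
  have r: "r > 0" using False L2_set_nonneg[of z I] unfolding r_def by linarith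
  have r2: "r\<^sup>2 = (\<Sum>a\<in>I. (z a)\<^sup>2)" by (simp add: r_def L2_set_def sum_nonneg)
  have bdd: "bdd_above ((\<lambda>z. quad_form I M z) ` {z. L2_set z I = 1})"
  proof (rule bdd_aboveI2)
    fix y assume "y \<in> {z. L2_set z I = 1}"
    hence y: "L2_set y I = 1" by simp
    have le1: "\<bar>y a\<bar> \<le> 1" if "a \<in> I" for a
      using member_le_L2_set[OF fin that, of "\<lambda>a. \<bar>y a\<bar>"] y by (simp add: L2_set_def)
    show "quad_form I M y \<le> (\<Sum>a\<in>I. \<Sum>b\<in>I. \<bar>M a b\<bar>)"
      unfolding quad_form_def
    proof (intro sum_mono)
      fix a b assume "a \<in> I" "b \<in> I"
      have "y a * M a b * y b \<le> \<bar>y a\<bar> * \<bar>M a b\<bar> * \<bar>y b\<bar>"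
        by (metis abs_ge_self abs_mult)
      also have "\<dots> \<le> 1 * \<bar>M a b\<bar> * 1"
        using le1 \<open>a \<in> I\<close> \<open>b \<in> I\<close> by (intro mult_mono) auto
      finally show "y a * M a b * y b \<le> \<bar>M a b\<bar>" by simp
    qed
  qed
  have "L2_set (\<lambda>a. z a / r) I = 1"
    using r by (simp add: L2_set_def power_divide r2[symmetric] flip: sum_divide_distrib)
  hence "quad_form I M (\<lambda>a. z a / r) \<le> (SUP z\<in>{z. L2_set z I = 1}. quad_form I M z)"
    by (intro cSUP_upper bdd) auto
  moreover have "quad_form I M (\<lambda>a. z a / r) = quad_form I M z / r\<^sup>2"
    unfolding quad_form_def by (simp add: sum_divide_distrib power2_eq_square)
  ultimately show ?thesis using r by (simp add: pos_divide_le_eq) (simp add: r2)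
qed

lemma quad_form_pairs:
  "quad_form (V \<times> V) M z = quad_sum V (\<lambda>a b c d. z (a, b) * M (a, b) (c, d) * z (c, d))"
  unfolding quad_form_def quad_sum_def by (simp add: sum.cartesian_product')

text \<open>The tensor is block diagonal along \<open>s = i \<oplus> j\<close>, with convolution by
  \<open>\<psi> s\<close> as block. It is therefore a combination of the rank-one tensors of
  \<open>z s c\<close> with weights \<open>\<phi> s c / 2 ^ k\<close>, nonnegative by
  \<open>pos\<close>, and \<open>M\<close> is tested on each \<open>z s c\<close> separately. The
  last factor is the trace.\<close>

lemma walsh_dual_bound:
  fixes \<psi> :: "nat \<Rightarrow> nat \<Rightarrow> real"
  assumes le: "2 ^ k \<le> n"
    and pos: "\<And>s c. \<lbrakk>s < 2 ^ k; c < 2 ^ k\<rbrakk> \<Longrightarrow> (\<Sum>t<2 ^ k. \<psi> s t * walsh k c t) \<ge> 0"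
    and M: "\<And>z. quad_form ({..<n} \<times> {..<n}) M z \<le> \<mu> * (\<Sum>a\<in>{..<n} \<times> {..<n}. (z a)\<^sup>2)"
  shows "quad_sum {..<n} (\<lambda>i j u v. M (i, j) (u, v) *
      (of_bool (i < 2 ^ k \<and> j < 2 ^ k \<and> u < 2 ^ k \<and> v < 2 ^ k \<and> i \<oplus> j = u \<oplus> v) * \<psi> (i \<oplus> j) (i \<oplus> u)))
    \<le> \<mu> * (2 ^ k * (\<Sum>s<2 ^ k. \<psi> s 0))"
proof -
  \<comment> \<open>\<open>\<phi> s c\<close> is the eigenvalue of block \<open>s\<close> at the
    character \<open>c\<close>; \<open>z s c\<close> is the eigenvector, supported on the pairs with
    XOR \<open>s\<close>.\<close>
  define \<phi> where "\<phi> s c = (\<Sum>t<2 ^ k. \<psi> s t * walsh k c t)" for s c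
  define z where "z s c = (\<lambda>(i, j). of_bool (i < 2 ^ k \<and> j < 2 ^ k \<and> i \<oplus> j = s) * walsh k c i)" for s c
  have norm_z: "(\<Sum>a\<in>{..<n} \<times> {..<n}. (z s c a)\<^sup>2) = 2 ^ k" if "s < 2 ^ k" for s c
  proof -
    have "(\<Sum>a\<in>{..<n} \<times> {..<n}. (z s c a)\<^sup>2) = (\<Sum>a\<in>(\<lambda>i. (i, i \<oplus> s)) ` {..<2 ^ k}. 1)"
    proof (rule sum.mono_neutral_cong_right)
      show "(\<lambda>i. (i, i \<oplus> s)) ` {..<2 ^ k} \<subseteq> {..<n} \<times> {..<n}"
        using le xor_less_power2[OF _ that] by fastforce
      show "\<forall>a\<in>{..<n} \<times> {..<n} - (\<lambda>i. (i, i \<oplus> s)) ` {..<2 ^ k}. (z s c a)\<^sup>2 = 0"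
        by (auto simp: z_def image_iff)
      show "(z s c a)\<^sup>2 = 1" if "a \<in> (\<lambda>i. (i, i \<oplus> s)) ` {..<2 ^ k}" for a
        using that xor_less_power2[OF _ \<open>s < 2 ^ k\<close>] by (auto simp: z_def power2_eq_square)
    qed auto
    also have "\<dots> = 2 ^ k" by (simp add: card_image inj_on_def)
    finally show ?thesis .
  qed
  have Mz: "quad_form ({..<n} \<times> {..<n}) M (z s c) \<le> \<mu> * 2 ^ k" if "s < 2 ^ k" for s c
    using M[of "z s c"] norm_z[OF that, of c] by simp
  have X: "of_bool (i < 2 ^ k \<and> j < 2 ^ k \<and> u < 2 ^ k \<and> v < 2 ^ k \<and> i \<oplus> j = u \<oplus> v) * \<psi> (i \<oplus> j) (i \<oplus> u)
      = (\<Sum>s<2 ^ k. \<Sum>c<2 ^ k. \<phi> s c / 2 ^ k * (z s c (i, j) * z s c (u, v)))" for i j u v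
  proof (cases "i < 2 ^ k \<and> j < 2 ^ k \<and> u < 2 ^ k \<and> v < 2 ^ k \<and> i \<oplus> j = u \<oplus> v")
    case True
    hence less: "i \<oplus> j < 2 ^ k" "i \<oplus> u < 2 ^ k" using xor_less_power2 by auto
    have "(\<Sum>s<2 ^ k. \<Sum>c<2 ^ k. \<phi> s c / 2 ^ k * (z s c (i, j) * z s c (u, v)))
      = (\<Sum>s<2 ^ k. if s = i \<oplus> j then \<Sum>c<2 ^ k. \<phi> s c / 2 ^ k * walsh k c (i \<oplus> u) else 0)"
      using True by (intro sum.cong refl) (auto simp: z_def walsh_xor)
    also have "\<dots> = (\<Sum>c<2 ^ k. \<phi> (i \<oplus> j) c * walsh k c (i \<oplus> u)) / 2 ^ k"
      using less(1) by (simp add: sum_divide_distrib)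
    also have "\<dots> = \<psi> (i \<oplus> j) (i \<oplus> u)"
      unfolding \<phi>_def walsh_inversion[OF less(2)] by simp
    finally show ?thesis using True by simp
  next
    case False
    have z0: "z s c (i, j) * z s c (u, v) = 0" for s c using False by (auto simp: z_def)
    show ?thesis unfolding z0 using False by auto
  qed
  have "quad_sum {..<n} (\<lambda>i j u v. M (i, j) (u, v) *
      (of_bool (i < 2 ^ k \<and> j < 2 ^ k \<and> u < 2 ^ k \<and> v < 2 ^ k \<and> i \<oplus> j = u \<oplus> v) * \<psi> (i \<oplus> j) (i \<oplus> u)))
    = (\<Sum>s<2 ^ k. \<Sum>c<2 ^ k. \<phi> s c / 2 ^ k * quad_form ({..<n} \<times> {..<n}) M (z s c))"
    unfolding X quad_form_pairs quad_sum_sum[symmetric] quad_sum_cmult[symmetric]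
    by (simp add: sum_distrib_left mult_ac)
  also have "\<dots> \<le> (\<Sum>s<2 ^ k. \<Sum>c<2 ^ k. \<phi> s c / 2 ^ k * (\<mu> * 2 ^ k))"
    using Mz pos by (intro sum_mono mult_left_mono) (auto simp: \<phi>_def)
  also have "\<dots> = \<mu> * (\<Sum>s<2 ^ k. \<Sum>c<2 ^ k. \<phi> s c * walsh k c 0)"
    by (simp add: sum_distrib_left mult_ac)
  \<comment> \<open>Inversion at \<open>t = 0\<close> turns the sum of the eigenvalues into the
    trace.\<close>
  also have "\<dots> = \<mu> * (\<Sum>s<2 ^ k. 2 ^ k * \<psi> s 0)"
    unfolding \<phi>_def by (subst walsh_inversion) auto
  finally show ?thesis by (simp add: sum_distrib_left)
qed

section \<open>The polynomial of a XOR hypergraph\<close>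

definition monom_eval :: "(nat \<Rightarrow>\<^sub>0 nat) \<Rightarrow> (nat \<Rightarrow> real) \<Rightarrow> real" where
  "monom_eval m x = (\<Prod>i\<in>Poly_Mapping.keys m. x i ^ Poly_Mapping.lookup m i)"

lemma monom_eval_superset:
  assumes "finite K" "Poly_Mapping.keys m \<subseteq> K"
  shows "monom_eval m x = (\<Prod>i\<in>K. x i ^ Poly_Mapping.lookup m i)"
  unfolding monom_eval_def
  by (rule prod.mono_neutral_left) (use assms in \<open>auto simp: in_keys_iff\<close>)

lemma monom_eval_add: "monom_eval (m + m') x = monom_eval m x * monom_eval m' x"
proof -
  let ?K = "Poly_Mapping.keys m \<union> Poly_Mapping.keys m'"
  have "monom_eval (m + m') x = (\<Prod>i\<in>?K. x i ^ Poly_Mapping.lookup (m + m') i)"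
    using keys_add[of m m'] by (intro monom_eval_superset) auto
  also have "\<dots> = (\<Prod>i\<in>?K. x i ^ Poly_Mapping.lookup m i) * (\<Prod>i\<in>?K. x i ^ Poly_Mapping.lookup m' i)"
    by (simp add: lookup_add power_add prod.distrib)
  also have "\<dots> = monom_eval m x * monom_eval m' x"
    using monom_eval_superset[of ?K m x] monom_eval_superset[of ?K m' x] by simp
  finally show ?thesis .
qed

lemma monom_eval_single [simp]: "monom_eval (Poly_Mapping.single i (Suc 0)) x = x i"
  by (simp add: monom_eval_def)

lemma poly_eval_superset:
  assumes "finite K" "Poly_Mapping.keys f \<subseteq> K"
  shows "poly_eval f x = (\<Sum>m\<in>K. Poly_Mapping.lookup f m * monom_eval m x)"
  unfolding poly_eval_def monom_eval_def
  by (rule sum.mono_neutral_left) (use assms in \<open>auto simp: in_keys_iff\<close>)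

lemma poly_eval_add: "poly_eval (f + g) x = poly_eval f x + poly_eval g x"
proof -
  let ?K = "Poly_Mapping.keys f \<union> Poly_Mapping.keys g"
  have "poly_eval (f + g) x = (\<Sum>m\<in>?K. Poly_Mapping.lookup (f + g) m * monom_eval m x)"
    using keys_add[of f g] by (intro poly_eval_superset) auto
  also have "\<dots> = (\<Sum>m\<in>?K. Poly_Mapping.lookup f m * monom_eval m x) + (\<Sum>m\<in>?K. Poly_Mapping.lookup g m * monom_eval m x)"
    by (simp add: lookup_add ring_distribs sum.distrib)
  also have "\<dots> = poly_eval f x + poly_eval g x"
    using poly_eval_superset[of ?K f x] poly_eval_superset[of ?K g x] by simp
  finally show ?thesis .
qed

lemma poly_eval_sum: "poly_eval (\<Sum>q\<in>A. f q) x = (\<Sum>q\<in>A. poly_eval (f q) x)"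
proof (induction A rule: infinite_finite_induct)
  case (insert q A)
  then show ?case by (simp add: poly_eval_add)
qed (simp_all add: poly_eval_def)

lemma poly_eval_single: "poly_eval (Poly_Mapping.single m r) x = r * monom_eval m x"
  by (subst poly_eval_superset[of "{m}"]) auto

definition quad_monom :: "nat \<Rightarrow> nat \<Rightarrow> nat \<Rightarrow> nat \<Rightarrow> nat \<Rightarrow>\<^sub>0 nat" where
  "quad_monom a b c d = Poly_Mapping.single a 1 + Poly_Mapping.single b 1 + Poly_Mapping.single c 1
     + Poly_Mapping.single d 1"

text \<open>Different quadruples may yield the same monomial; their coefficients add up.\<close>

definition quartic_poly :: "nat \<Rightarrow> (nat \<Rightarrow> nat \<Rightarrow> nat \<Rightarrow> nat \<Rightarrow> real) \<Rightarrow> mpoly" where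
  "quartic_poly n F =
     (\<Sum>a<n. \<Sum>b<n. \<Sum>c<n. \<Sum>d<n. Poly_Mapping.single (quad_monom a b c d) (F a b c d))"

lemma poly_eval_quartic_poly:
  "poly_eval (quartic_poly n F) x = quad_sum {..<n} (\<lambda>a b c d. F a b c d * (x a * x b * x c * x d))"
  unfolding quartic_poly_def quad_sum_def
  by (simp add: poly_eval_sum poly_eval_single quad_monom_def monom_eval_add)

lemma sum_keys_add:
  "(\<Sum>i\<in>Poly_Mapping.keys (m + m'). Poly_Mapping.lookup (m + m') i)
    = (\<Sum>i\<in>Poly_Mapping.keys m. Poly_Mapping.lookup m i) + (\<Sum>i\<in>Poly_Mapping.keys m'. Poly_Mapping.lookup m' i)"
  for m m' :: "nat \<Rightarrow>\<^sub>0 nat"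
proof -
  let ?K = "Poly_Mapping.keys m \<union> Poly_Mapping.keys m'"
  have *: "(\<Sum>i\<in>Poly_Mapping.keys p. Poly_Mapping.lookup p i) = (\<Sum>i\<in>?K. Poly_Mapping.lookup p i)"
    if "Poly_Mapping.keys p \<subseteq> ?K" for p :: "nat \<Rightarrow>\<^sub>0 nat"
    by (rule sum.mono_neutral_left) (use that in \<open>auto simp: in_keys_iff\<close>)
  show ?thesis
    using keys_add[of m m'] *[of m] *[of m'] *[of "m + m'"] by (simp add: lookup_add sum.distrib)
qed

lemma homogeneous_quartic_poly: "homogeneous_poly n 4 (quartic_poly n F)"
  unfolding homogeneous_poly_def
proof (intro ballI)
  fix m assume "m \<in> Poly_Mapping.keys (quartic_poly n F)"
  then obtain a b c d where abcd: "a < n" "b < n" "c < n" "d < n" and m: "m = quad_monom a b c d"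
    unfolding quartic_poly_def
    by (auto dest!: subsetD[OF keys_sum] split: if_splits)
  have "Poly_Mapping.keys m \<subseteq> {a, b, c, d}"
    unfolding m quad_monom_def by (auto dest!: subsetD[OF keys_add] split: if_splits)
  moreover have "(\<Sum>i\<in>Poly_Mapping.keys m. Poly_Mapping.lookup m i) = 4"
    unfolding m quad_monom_def sum_keys_add by simp
  ultimately show "Poly_Mapping.keys m \<subseteq> {..<n} \<and> (\<Sum>i\<in>Poly_Mapping.keys m. Poly_Mapping.lookup m i) = 4"
    using abcd by auto
qed

lemma nonneg_quartic_poly:
  assumes "\<And>a b c d. F a b c d \<ge> 0"
  shows "nonneg_coeffs (quartic_poly n F)"
  unfolding nonneg_coeffs_def quartic_poly_def
  by (auto simp: lookup_sum lookup_single when_def assms intro!: sum_nonneg)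

lemma quad_form_tensor_sq:
  "quad_form (V \<times> V) M (tensor_sq x) = quad_sum V (\<lambda>a b c d. M (a, b) (c, d) * (x a * x b * x c * x d))"
  unfolding quad_form_pairs tensor_sq_def by (simp add: mult_ac)

section \<open>The clique polynomial, its norm and its pseudo-moments\<close>

text \<open>The vertices are the numbers below \<open>2 ^ k\<close>; the variables from
  \<open>2 ^ k\<close> to \<open>n - 1\<close> only pad the dimension.\<close>

locale xor_hypergraph =
  fixes k n :: nat and S :: "nat set"
  assumes le_n: "2 ^ k \<le> n" and S_sub: "S \<subseteq> {1..<2 ^ k}"
begin

lemma S_lt: "s \<in> S \<Longrightarrow> s < 2 ^ k" and zero_notin [simp]: "0 \<notin> S"
  using S_sub by auto

lemma finite_S [simp]: "finite S"
  using S_sub finite_subset by blast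

text \<open>As the XOR of all four is zero, opposite pairs have equal XOR, so three memberships in
  \<open>S\<close> cover all six pairs.\<close>

definition hyperedge :: "nat \<Rightarrow> nat \<Rightarrow> nat \<Rightarrow> nat \<Rightarrow> bool" where
  "hyperedge i j u v \<longleftrightarrow> i < 2 ^ k \<and> j < 2 ^ k \<and> u < 2 ^ k \<and> v < 2 ^ k \<and> i \<oplus> j = u \<oplus> v \<and>
     i \<oplus> j \<in> S \<and> i \<oplus> u \<in> S \<and> i \<oplus> v \<in> S"

definition edge :: "nat \<Rightarrow> nat \<Rightarrow> bool" where
  "edge x y \<longleftrightarrow> x < 2 ^ k \<and> y < 2 ^ k \<and> x \<oplus> y \<in> S"

abbreviation "clique_poly \<equiv> quartic_poly n (\<lambda>i j u v. of_bool (hyperedge i j u v))"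

abbreviation "triangles \<equiv> card {(s, t). s \<in> S \<and> t \<in> S \<and> s \<oplus> t \<in> S}"

lemma xor_eq_xor_iff: "i \<oplus> j = u \<oplus> v \<longleftrightarrow> v = i \<oplus> j \<oplus> u" for i j u v :: nat
  by (metis xor.commute xor_left_self)

lemma hyperedge_imp_clique:
  assumes "hyperedge i j u v"
  shows "edge i j \<and> edge i u \<and> edge i v \<and> edge j u \<and> edge j v \<and> edge u v"
proof -
  have v: "v = i \<oplus> j \<oplus> u" using assms by (simp add: hyperedge_def xor_eq_xor_iff)
  have "j \<oplus> u = i \<oplus> v" "j \<oplus> v = i \<oplus> u" "u \<oplus> v = i \<oplus> j"
    unfolding v by (simp_all add: ac_simps)
  thus ?thesis using assms by (simp add: hyperedge_def edge_def)
qed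

text \<open>A hyperedge amounts to a vertex \<open>i\<close> and a pair
  \<open>s = i \<oplus> j\<close>, \<open>t = i \<oplus> u\<close> with \<open>s\<close>,
  \<open>t\<close> and \<open>s \<oplus> t\<close> in \<open>S\<close>; this is the form in which
  hyperedges are counted.\<close>

lemma hyperedge_iff:
  "hyperedge i j u v \<longleftrightarrow> i < 2 ^ k \<and> j < 2 ^ k \<and> u < 2 ^ k \<and> v = i \<oplus> j \<oplus> u \<and>
     i \<oplus> j \<in> S \<and> i \<oplus> u \<in> S \<and> (i \<oplus> j) \<oplus> (i \<oplus> u) \<in> S"
proof -
  have eq: "i \<oplus> (i \<oplus> j \<oplus> u) = (i \<oplus> j) \<oplus> (i \<oplus> u)" by (simp add: ac_simps)
  have "v = i \<oplus> j \<oplus> u \<Longrightarrow> i \<oplus> v \<in> S \<longleftrightarrow> (i \<oplus> j) \<oplus> (i \<oplus> u) \<in> S"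
    by (simp only: eq)
  moreover have "v = i \<oplus> j \<oplus> u \<Longrightarrow> i < 2 ^ k \<Longrightarrow> j < 2 ^ k \<Longrightarrow> u < 2 ^ k \<Longrightarrow> v < 2 ^ k"
    by (simp only: xor_less_power2)
  ultimately show ?thesis unfolding hyperedge_def xor_eq_xor_iff by blast
qed

lemma hyperedge_swap:
  assumes "hyperedge i j u v"
  shows "hyperedge u v i j"
  using hyperedge_imp_clique[OF assms] assms
  unfolding hyperedge_def edge_def xor.commute[of u i] xor.commute[of u j] by simp

text \<open>Translation by \<open>a\<close> carries the common neighbours of \<open>a\<close>,
  \<open>b\<close>, \<open>c\<close> into the set bounded by \<open>common\<close> for
  \<open>a \<oplus> b\<close> and \<open>a \<oplus> c\<close>. The clique bound then applies to the
  absolute values of the coordinates.\<close>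

lemma poly_norm2_clique_poly:
  assumes common: "\<And>a b. \<lbrakk>a < 2 ^ k; b < 2 ^ k; a \<noteq> 0; b \<noteq> 0; a \<noteq> b\<rbrakk>
      \<Longrightarrow> card {x \<in> S. x \<oplus> a \<in> S \<and> x \<oplus> b \<in> S} \<le> t"
  shows "poly_norm2 n clique_poly \<le> 24 * (t * (t + 2))"
proof -
  interpret k3t_free "{..<n}" edge t
  proof
    show "edge x y \<Longrightarrow> edge y x" for x y by (simp add: edge_def xor.commute)
    show "\<not> edge x x" for x by (simp add: edge_def)
    fix a b c :: nat assume "a \<noteq> b" "a \<noteq> c" "b \<noteq> c"
    show "card {x \<in> {..<n}. edge x a \<and> edge x b \<and> edge x c} \<le> t"
    proof (cases "a < 2 ^ k \<and> b < 2 ^ k \<and> c < 2 ^ k")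
      case True
      have "card {x \<in> {..<n}. edge x a \<and> edge x b \<and> edge x c}
        \<le> card {x \<in> S. x \<oplus> (a \<oplus> b) \<in> S \<and> x \<oplus> (a \<oplus> c) \<in> S}"
      proof (rule card_inj_on_le[where f = "\<lambda>x. x \<oplus> a"])
        show "inj_on (\<lambda>x. x \<oplus> a) {x \<in> {..<n}. edge x a \<and> edge x b \<and> edge x c}"
          by (rule inj_onI) (metis xor_right_self)
        show "(\<lambda>x. x \<oplus> a) ` {x \<in> {..<n}. edge x a \<and> edge x b \<and> edge x c}
          \<subseteq> {x \<in> S. x \<oplus> (a \<oplus> b) \<in> S \<and> x \<oplus> (a \<oplus> c) \<in> S}"
          by (auto simp: edge_def xor.assoc)
      qed auto
      also have "\<dots> \<le> t"
      proof (rule common)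
        show "a \<oplus> b \<noteq> a \<oplus> c" using \<open>b \<noteq> c\<close> by (metis xor_left_self)
      qed (use True \<open>a \<noteq> b\<close> \<open>a \<noteq> c\<close> xor_less_power2 in auto)
      finally show ?thesis .
    next
      case False
      hence "{x \<in> {..<n}. edge x a \<and> edge x b \<and> edge x c} = {}" by (auto simp: edge_def)
      thus ?thesis by (metis card.empty zero_le)
    qed
  qed simp
  have n0: "0 < n" using le_n by (metis gr0I le_zero_eq power_not_zero zero_neq_numeral)
  show ?thesis unfolding poly_norm2_def
  proof (rule cSUP_least)
    have "L2_set (\<lambda>i. of_bool (i = 0)) {..<n} = 1"
      using n0 by (simp add: L2_set_def power2_eq_square of_bool_def if_distrib[of "\<lambda>x. x * _"] cong: if_cong)
    thus "{x. L2_set x {..<n} = 1} \<noteq> {}" by blast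
    fix x assume "x \<in> {x. L2_set x {..<n} = 1}"
    hence x: "(\<Sum>i<n. (x i)\<^sup>2) = 1" by (simp add: L2_set_def)
    have "\<bar>poly_eval clique_poly x\<bar>
      \<le> quad_sum {..<n} (\<lambda>i j u v. of_bool (hyperedge i j u v) * (\<bar>x i\<bar> * \<bar>x j\<bar> * \<bar>x u\<bar> * \<bar>x v\<bar>))"
      unfolding poly_eval_quartic_poly quad_sum_def
      by (intro order_trans[OF sum_abs] sum_mono) (simp add: abs_mult)
    also have "\<dots> \<le> quad_sum {..<n} (\<lambda>v u w z. of_bool (edge v u \<and> edge v w \<and> edge v z \<and> edge u w \<and> edge u z \<and> edge w z)
        * (\<bar>x v\<bar> * \<bar>x u\<bar> * \<bar>x w\<bar> * \<bar>x z\<bar>))"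
      using hyperedge_imp_clique by (intro quad_sum_mono mult_right_mono) auto
    also have "\<dots> \<le> 24 * (t * (t + 2))"
      by (rule clique_sum_bound) (simp_all add: x)
    finally show "\<bar>poly_eval clique_poly x\<bar> \<le> 24 * (t * (t + 2))" .
  qed
qed

lemma sum_restrict_less: "(\<Sum>j<n. of_bool (j < 2 ^ k) * h j) = (\<Sum>j<2 ^ k. h j)" for h :: "nat \<Rightarrow> real"
  by (rule sum.mono_neutral_cong_right) (use le_n in auto)

lemma sum_hyperedges:
  "quad_sum {..<n} (\<lambda>i j u v. of_bool (hyperedge i j u v)) = 2 ^ k * real triangles"
proof -
  define T where "T s t \<longleftrightarrow> s \<in> S \<and> t \<in> S \<and> s \<oplus> t \<in> S" for s t
  have "quad_sum {..<n} (\<lambda>i j u v. of_bool (hyperedge i j u v))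
    = (\<Sum>i<n. \<Sum>j<n. \<Sum>u<n. of_bool (i < 2 ^ k) * (of_bool (j < 2 ^ k) * (of_bool (u < 2 ^ k) * of_bool (T (i \<oplus> j) (i \<oplus> u)))))"
    unfolding quad_sum_def
  proof (intro sum.cong refl)
    fix i j u
    have "(\<Sum>v<n. of_bool (hyperedge i j u v) :: real)
      = (\<Sum>v<n. if v = i \<oplus> j \<oplus> u then of_bool (i < 2 ^ k \<and> j < 2 ^ k \<and> u < 2 ^ k \<and> T (i \<oplus> j) (i \<oplus> u)) else 0)"
      by (intro sum.cong refl) (auto simp: hyperedge_iff T_def)
    also have "\<dots> = of_bool (i < 2 ^ k \<and> j < 2 ^ k \<and> u < 2 ^ k \<and> T (i \<oplus> j) (i \<oplus> u))"
      using xor_less_power2[of "i \<oplus> j" k u] xor_less_power2[of i k j] le_n by auto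
    finally show "(\<Sum>v<n. of_bool (hyperedge i j u v) :: real)
      = of_bool (i < 2 ^ k) * (of_bool (j < 2 ^ k) * (of_bool (u < 2 ^ k) * of_bool (T (i \<oplus> j) (i \<oplus> u))))"
      by simp
  qed
  also have "\<dots> = (\<Sum>i::nat<2 ^ k. \<Sum>j<2 ^ k. \<Sum>u<2 ^ k. of_bool (T (i \<oplus> j) (i \<oplus> u)))"
    by (simp only: sum_distrib_left[symmetric] sum_restrict_less)
  also have "\<dots> = (\<Sum>i::nat<2 ^ k. \<Sum>s<2 ^ k. \<Sum>t<2 ^ k. of_bool (T s t))"
  proof (rule sum.cong[OF refl])
    fix i :: nat assume "i \<in> {..<2 ^ k}"
    hence i: "i < 2 ^ k" by simp
    show "(\<Sum>j<2 ^ k. \<Sum>u<2 ^ k. of_bool (T (i \<oplus> j) (i \<oplus> u)) :: real) = (\<Sum>s<2 ^ k. \<Sum>t<2 ^ k. of_bool (T s t))"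
      unfolding sum_xor[OF i, of "\<lambda>t. of_bool (T (i \<oplus> _) t)"]
      by (rule sum_xor[OF i, of "\<lambda>s. \<Sum>t<2 ^ k. of_bool (T s t)"])
  qed
  also have "\<dots> = 2 ^ k * (\<Sum>s<2 ^ k. \<Sum>t<2 ^ k. of_bool (T s t))" by simp
  also have "(\<Sum>s<2 ^ k. \<Sum>t<2 ^ k. of_bool (T s t)) = real triangles"
  proof -
    have "(\<Sum>s<2 ^ k. \<Sum>t<2 ^ k. of_bool (T s t)) = (\<Sum>(s, t)\<in>{..<2 ^ k} \<times> {..<2 ^ k}. of_bool (T s t) :: real)"
      by (rule sum.cartesian_product)
    also have "\<dots> = (\<Sum>p\<in>{..<2 ^ k} \<times> {..<2 ^ k}. of_bool (case p of (s, t) \<Rightarrow> T s t))"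
      by (intro sum.cong refl) auto
    also have "\<dots> = real (card {p \<in> {..<2 ^ k} \<times> {..<2 ^ k}. case p of (s, t) \<Rightarrow> T s t})"
      by (rule sum_of_bool_eq_card) simp
    also have "{p \<in> {..<2 ^ k} \<times> {..<2 ^ k}. case p of (s, t) \<Rightarrow> T s t} = {(s, t). s \<in> S \<and> t \<in> S \<and> s \<oplus> t \<in> S}"
      using S_lt by (auto simp: T_def)
    finally show ?thesis .
  qed
  finally show ?thesis .
qed

text \<open>
  The pseudo-moment \<open>of_bool (i \<oplus> j = u \<oplus> v) * moment L (i \<oplus> j) (i \<oplus> u)\<close> of
  \<open>x i * x j * x u * x v\<close> is 1 on hyperedges, \<open>L\<close> on pairs of squares joined by an edge, and
  \<open>L * card S\<close> on fourth powers.
\<close>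

definition moment :: "real \<Rightarrow> nat \<Rightarrow> nat \<Rightarrow> real" where
  "moment L s t =
     (if s = 0 \<and> t = 0 then L * card S
      else if s = 0 then L * of_bool (t \<in> S)
      else if t = 0 \<or> s = t then L * of_bool (s \<in> S)
      else of_bool (s \<in> S \<and> t \<in> S \<and> s \<oplus> t \<in> S))"

lemma moment_commute: "moment L s t = moment L t s"
  unfolding moment_def xor.commute[of t s] by auto

text \<open>Exchanging \<open>u\<close> and \<open>v\<close> in a quadruple with XOR zero replaces
  \<open>t = i \<oplus> u\<close> by \<open>s \<oplus> t\<close>. Together with
  \<open>moment_commute\<close> this makes the pseudo-moment fully symmetric.\<close>

lemma moment_xor: "moment L s (s \<oplus> t) = moment L s t"
  by (auto simp: moment_def)

text \<open>For \<open>s = 0\<close> the fourth powers outweigh the edges, as characters are at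
  least -1. For \<open>s\<close> in \<open>S\<close> the transform is
  \<open>L + L * walsh k c s + W\<close>: if the sign is 1, \<open>large\<close> applies; if it is
  -1, translation by \<open>s\<close> negates \<open>W\<close>, so all terms cancel. Other blocks
  vanish.\<close>

lemma moment_transform_nonneg:
  fixes L :: real
  assumes L: "L \<ge> 0" and c: "c < 2 ^ k" and s: "s < 2 ^ k"
    and large: "\<And>s. \<lbrakk>s \<in> S; walsh k c s = 1\<rbrakk> \<Longrightarrow> (\<Sum>t | t \<in> S \<and> s \<oplus> t \<in> S. walsh k c t) \<ge> - (2 * L)"
  shows "(\<Sum>t<2 ^ k. moment L s t * walsh k c t) \<ge> 0"
proof -
  consider "s = 0" | "s \<in> S" | "s \<noteq> 0" "s \<notin> S" by auto
  thus ?thesis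
  proof cases
    case 1
    have "(\<Sum>t<2 ^ k. moment L s t * walsh k c t)
      = (\<Sum>t<2 ^ k. (if t = 0 then L * card S else 0) + (if t \<in> S then L * walsh k c t else 0))"
      by (intro sum.cong refl) (auto simp: 1 moment_def)
    also have "\<dots> = L * card S + (\<Sum>t\<in>S. L * walsh k c t)"
    proof -
      have "{..<2 ^ k} \<inter> S = S" using S_lt by auto
      thus ?thesis by (simp add: sum.distrib sum.If_cases)
    qed
    also have "\<dots> \<ge> L * card S + (\<Sum>t\<in>S. L * (- 1))"
      using L walsh_ge by (intro add_left_mono sum_mono mult_left_mono) auto
    finally show ?thesis by simp
  next
    case 2
    have s0: "s \<noteq> 0" using 2 by (metis zero_notin)
    define W where "W = (\<Sum>t | t \<in> S \<and> s \<oplus> t \<in> S. walsh k c t)"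
    have "(\<Sum>t<2 ^ k. moment L s t * walsh k c t)
      = (\<Sum>t<2 ^ k. (if t = 0 then L else 0) + (if t = s then L * walsh k c s else 0)
          + (if t \<in> S \<and> s \<oplus> t \<in> S then walsh k c t else 0))"
      using 2 s0 by (intro sum.cong refl) (auto simp: moment_def)
    also have "\<dots> = L + L * walsh k c s + W"
    proof -
      have "{..<2 ^ k} \<inter> {t. t \<in> S \<and> s \<oplus> t \<in> S} = {t. t \<in> S \<and> s \<oplus> t \<in> S}" using S_lt by auto
      thus ?thesis using s by (simp add: sum.distrib sum.If_cases W_def)
    qed
    also have "\<dots> \<ge> 0"
    proof (cases "walsh k c s = 1")
      case True
      thus ?thesis using large[OF 2] by (simp add: W_def)
    next
      case False
      hence m: "walsh k c s = - 1" using walsh_cases[of k c s] by auto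
      have "W = (\<Sum>t | t \<in> S \<and> s \<oplus> t \<in> S. walsh k c (s \<oplus> t))"
        unfolding W_def
        by (rule sum.reindex_bij_witness[of _ "\<lambda>t. s \<oplus> t" "\<lambda>t. s \<oplus> t"]) auto
      also have "\<dots> = - W" by (simp add: W_def walsh_xor m sum_negf)
      finally show ?thesis using m by simp
    qed
    finally show ?thesis .
  next
    case 3
    hence "moment L s t = 0" for t by (simp add: moment_def)
    thus ?thesis by simp
  qed
qed

text \<open>Any representation \<open>M\<close> has the same pairing with the pseudo-moment
  \<open>X\<close> as the clique indicator \<open>F\<close>, namely the number of hyperedges,
  \<open>2 ^ k\<close> times \<open>triangles\<close>. Dividing by the trace
  \<open>2 ^ k * (2 * L * card S)\<close> bounds the supremum of \<open>M\<close> from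
  below.\<close>

lemma Lambda_rep_clique_poly:
  fixes L :: real
  assumes L: "L > 0" and S: "S \<noteq> {}"
    and large: "\<And>s c. \<lbrakk>s \<in> S; c < 2 ^ k; walsh k c s = 1\<rbrakk>
      \<Longrightarrow> (\<Sum>t | t \<in> S \<and> s \<oplus> t \<in> S. walsh k c t) \<ge> - (2 * L)"
  shows "Lambda_rep n clique_poly \<ge> triangles / (2 * L * card S)"
  unfolding Lambda_rep_def
proof (rule cINF_greatest)
  let ?V = "{..<n}"
  define F where "F = (\<lambda>i j u v. of_bool (hyperedge i j u v) :: real)"
  have "matrix_rep n clique_poly (\<lambda>(i, j) (u, v). F i j u v)"
    unfolding matrix_rep_def quad_form_tensor_sq poly_eval_quartic_poly
    using hyperedge_swap by (auto simp: F_def)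
  thus "{M. matrix_rep n clique_poly M} \<noteq> {}" by blast
  fix M assume "M \<in> {M. matrix_rep n clique_poly M}"
  hence M: "quad_form (?V \<times> ?V) M (tensor_sq x) = poly_eval clique_poly x" for x
    by (simp add: matrix_rep_def)
  define \<mu> where "\<mu> = (SUP z\<in>{z. L2_set z (?V \<times> ?V) = 1}. quad_form (?V \<times> ?V) M z)"
  define X where "X = (\<lambda>i j u v. of_bool (i < 2 ^ k \<and> j < 2 ^ k \<and> u < 2 ^ k \<and> v < 2 ^ k \<and> i \<oplus> j = u \<oplus> v)
    * moment L (i \<oplus> j) (i \<oplus> u))"
  have sym: "X i j u v = X j i u v" "X i j u v = X i u j v" "X i j u v = X i j v u" for i j u v
  proof -
    have "moment L (j \<oplus> i) (j \<oplus> u) = moment L (i \<oplus> j) (i \<oplus> u)"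
      using moment_xor[of L "i \<oplus> j" "i \<oplus> u"] by (simp add: ac_simps)
    thus "X i j u v = X j i u v" by (simp add: X_def xor.commute[of i j])
    show "X i j u v = X i u j v"
      unfolding X_def xor_eq_xor_iff moment_commute[of L "i \<oplus> u"]
      by (auto simp: ac_simps)
    show "X i j u v = X i j v u"
    proof (cases "i \<oplus> j = u \<oplus> v")
      case True
      hence "v = i \<oplus> j \<oplus> u" using xor_eq_xor_iff by blast
      hence "i \<oplus> v = (i \<oplus> j) \<oplus> (i \<oplus> u)" by (simp add: ac_simps)
      hence "moment L (i \<oplus> j) (i \<oplus> v) = moment L (i \<oplus> j) (i \<oplus> u)" by (simp only: moment_xor)
      thus ?thesis unfolding X_def by (simp add: xor.commute[of u v] conj_ac)
    next
      case False
      thus ?thesis by (simp add: X_def xor.commute[of v u])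
    qed
  qed
  have FX: "F i j u v * X i j u v = F i j u v" for i j u v
  proof (cases "hyperedge i j u v")
    case True
    hence "i \<oplus> j \<in> S" "i \<oplus> u \<in> S" "(i \<oplus> j) \<oplus> (i \<oplus> u) \<in> S" by (simp_all add: hyperedge_iff)
    moreover from this have "i \<oplus> j \<noteq> 0" "i \<oplus> u \<noteq> 0" "i \<oplus> j \<noteq> i \<oplus> u"
      using zero_notin by (metis xor_self_eq)+
    ultimately have "moment L (i \<oplus> j) (i \<oplus> u) = 1" by (simp only: moment_def) simp
    thus ?thesis using True unfolding X_def hyperedge_def by simp
  qed (simp add: F_def)
  have "quad_sum ?V (\<lambda>a b c d. (M (a, b) (c, d) - F a b c d) * X a b c d) = 0"
  proof (rule symmetric_pairing_zero)
    show "quad_sum ?V (\<lambda>a b c d. (M (a, b) (c, d) - F a b c d) * (x a * x b * x c * x d)) = 0" for x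
      using M[of x] unfolding quad_form_tensor_sq poly_eval_quartic_poly F_def
      by (simp add: left_diff_distrib quad_sum_def sum_subtractf)
  qed (use sym in simp_all)
  hence "quad_sum ?V (\<lambda>a b c d. M (a, b) (c, d) * X a b c d) = quad_sum ?V (\<lambda>a b c d. F a b c d * X a b c d)"
    by (simp add: left_diff_distrib quad_sum_def sum_subtractf)
  also have "\<dots> = 2 ^ k * real triangles"
    unfolding FX unfolding F_def by (rule sum_hyperedges)
  finally have "2 ^ k * real triangles = quad_sum ?V (\<lambda>a b c d. M (a, b) (c, d) * X a b c d)" by simp
  also have "\<dots> \<le> \<mu> * (2 ^ k * (\<Sum>s<2 ^ k. moment L s 0))"
    unfolding X_def
  proof (rule walsh_dual_bound[OF le_n])
    show "(\<Sum>t<2 ^ k. moment L s t * walsh k c t) \<ge> 0" if "s < 2 ^ k" "c < 2 ^ k" for s c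
      using L that large by (intro moment_transform_nonneg) auto
    show "quad_form (?V \<times> ?V) M z \<le> \<mu> * (\<Sum>a\<in>?V \<times> ?V. (z a)\<^sup>2)" for z
      unfolding \<mu>_def by (rule quad_form_le_sup_sphere) simp
  qed
  \<comment> \<open>The fourth powers and the squares along edges each contribute
    \<open>L * card S\<close>.\<close>
  also have "(\<Sum>s<2 ^ k. moment L s 0) = 2 * L * card S"
  proof -
    have "(\<Sum>s<2 ^ k. moment L s 0) = (\<Sum>s<2 ^ k. (if s = 0 then L * card S else 0) + (if s \<in> S then L else 0))"
      by (intro sum.cong refl) (auto simp: moment_def)
    also have "\<dots> = 2 * L * card S"
    proof -
      have "{..<2 ^ k} \<inter> S = S" using S_lt by auto
      thus ?thesis by (simp add: sum.distrib sum.If_cases)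
    qed
    finally show ?thesis .
  qed
  finally have "real triangles \<le> \<mu> * (2 * L * card S)" by simp
  moreover have "0 < 2 * L * card S" using L S by (simp add: card_gt_0_iff)
  ultimately show "triangles / (2 * L * card S) \<le> \<mu>"
    by (simp add: pos_divide_le_eq)
qed

end

section \<open>Random sets\<close>

text \<open>The expectation of \<open>g\<close> at a random subset of \<open>U\<close> containing
  each element independently with probability \<open>p\<close>, as a finite sum.\<close>

definition random_mean :: "'a set \<Rightarrow> real \<Rightarrow> ('a set \<Rightarrow> real) \<Rightarrow> real" where
  "random_mean U p g = (\<Sum>S\<in>Pow U. p ^ card S * (1 - p) ^ card (U - S) * g S)"

lemma random_mean_add: "random_mean U p (\<lambda>S. f S + g S) = random_mean U p f + random_mean U p g"
  unfolding random_mean_def by (simp add: ring_distribs sum.distrib)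

lemma random_mean_diff: "random_mean U p (\<lambda>S. f S - g S) = random_mean U p f - random_mean U p g"
  unfolding random_mean_def by (simp add: ring_distribs sum_subtractf)

lemma random_mean_cmult: "random_mean U p (\<lambda>S. r * g S) = r * random_mean U p g"
  unfolding random_mean_def by (simp add: sum_distrib_left mult_ac)

lemma random_mean_sum: "random_mean U p (\<lambda>S. \<Sum>i\<in>I. g i S) = (\<Sum>i\<in>I. random_mean U p (g i))"
  unfolding random_mean_def sum_distrib_left by (rule sum.swap)

lemma random_mean_cong:
  assumes "\<And>S. S \<subseteq> U \<Longrightarrow> f S = g S"
  shows "random_mean U p f = random_mean U p g"
  unfolding random_mean_def by (intro sum.cong refl) (simp add: assms)

text \<open>The product of \<open>p\<close> over \<open>A\<close> and of \<open>p + (1 - p)\<close>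
  outside \<open>A\<close> expands over subsets of \<open>U\<close>; those missing an element of
  \<open>A\<close> receive a factor 0.\<close>

lemma random_mean_subset:
  fixes p :: real
  assumes "finite U" "A \<subseteq> U"
  shows "random_mean U p (\<lambda>S. of_bool (A \<subseteq> S)) = p ^ card A"
proof -
  have "p ^ card A = (\<Prod>x\<in>U. if x \<in> A then p else 1)"
    using assms by (simp add: prod.If_cases Int_absorb1)
  also have "\<dots> = (\<Prod>x\<in>U. p + (if x \<in> A then 0 else 1 - p))"
    by (intro prod.cong) auto
  also have "\<dots> = (\<Sum>S\<in>Pow U. (\<Prod>x\<in>S. p) * (\<Prod>x\<in>U-S. if x \<in> A then 0 else 1 - p))"
    by (rule prod_add[OF assms(1)])
  also have "\<dots> = random_mean U p (\<lambda>S. of_bool (A \<subseteq> S))"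
    unfolding random_mean_def
  proof (intro sum.cong refl)
    fix S assume S: "S \<in> Pow U"
    show "(\<Prod>x\<in>S. p) * (\<Prod>x\<in>U-S. if x \<in> A then 0 else 1 - p)
      = p ^ card S * (1 - p) ^ card (U - S) * of_bool (A \<subseteq> S)"
    proof (cases "A \<subseteq> S")
      case True
      have "(\<Prod>x\<in>U-S. if x \<in> A then 0 else 1 - p) = (\<Prod>x\<in>U-S. 1 - p)"
        using True by (intro prod.cong) auto
      thus ?thesis using True by simp
    next
      case False
      then obtain a where "a \<in> A" "a \<notin> S" by auto
      hence "(\<Prod>x\<in>U-S. if x \<in> A then 0 else 1 - p) = 0"
        using assms by (intro prod_zero) auto
      thus ?thesis using False by simp
    qed
  qed
  finally show ?thesis by simp
qed

lemma random_mean_pos_imp_ex: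
  fixes p :: real
  assumes "0 \<le> p" "p \<le> 1" "random_mean U p g > 0"
  obtains S where "S \<subseteq> U" "g S > 0"
proof -
  have "\<exists>S\<in>Pow U. g S > 0"
  proof (rule ccontr)
    assume "\<not> ?thesis"
    hence "random_mean U p g \<le> 0"
      unfolding random_mean_def using assms(1,2)
      by (intro sum_nonpos mult_nonneg_nonpos mult_nonneg_nonneg zero_le_power) (auto simp: not_less)
    thus False using assms(3) by simp
  qed
  thus ?thesis using that by auto
qed

text \<open>Independence of the events \<open>P t \<subseteq> S\<close>: the product is expanded
  over subsets \<open>X\<close> of \<open>R\<close>, the blocks in \<open>X\<close> have
  \<open>r * card X\<close> elements in all, and the resulting sum is folded back into a
  product.\<close>

lemma random_mean_prod_disjoint:
  fixes p :: real
  assumes fin: "finite U" "finite R"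
    and P: "\<And>t. t \<in> R \<Longrightarrow> P t \<subseteq> U" "\<And>t. t \<in> R \<Longrightarrow> card (P t) = r"
    and disj: "disjoint_family_on P R"
  shows "random_mean U p (\<lambda>S. \<Prod>t\<in>R. d t * of_bool (P t \<subseteq> S) + 1) = (\<Prod>t\<in>R. d t * p ^ r + 1)"
proof -
  have fP: "finite (P t)" if "t \<in> R" for t using P(1)[OF that] fin(1) by (rule finite_subset)
  have "random_mean U p (\<lambda>S. \<Prod>t\<in>R. d t * of_bool (P t \<subseteq> S) + 1)
    = random_mean U p (\<lambda>S. \<Sum>X\<in>Pow R. prod d X * of_bool ((\<Union>t\<in>X. P t) \<subseteq> S))"
  proof (rule random_mean_cong)
    fix S
    have "(\<Prod>t\<in>X. d t * of_bool (P t \<subseteq> S)) = prod d X * of_bool ((\<Union>t\<in>X. P t) \<subseteq> S)" if "X \<subseteq> R" for X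
    proof -
      have "finite X" using that fin(2) by (rule finite_subset)
      thus ?thesis by (induction X) auto
    qed
    thus "(\<Prod>t\<in>R. d t * of_bool (P t \<subseteq> S) + 1) = (\<Sum>X\<in>Pow R. prod d X * of_bool ((\<Union>t\<in>X. P t) \<subseteq> S))"
      unfolding prod_add[OF fin(2)] by (intro sum.cong) auto
  qed
  also have "\<dots> = (\<Sum>X\<in>Pow R. prod d X * p ^ card (\<Union>t\<in>X. P t))"
    unfolding random_mean_sum random_mean_cmult
    using P(1) by (intro sum.cong arg_cong2[where f = "(*)"] refl random_mean_subset[OF fin(1)]) auto
  also have "\<dots> = (\<Sum>X\<in>Pow R. (\<Prod>t\<in>X. d t * p ^ r) * (\<Prod>t\<in>R-X. 1))"
  proof (intro sum.cong refl)
    fix X assume "X \<in> Pow R"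
    hence X: "X \<subseteq> R" by simp
    have "card (\<Union>t\<in>X. P t) = (\<Sum>t\<in>X. card (P t))"
    proof (rule card_UN_disjoint)
      show "finite X" using X fin(2) by (rule finite_subset)
      show "\<forall>t\<in>X. finite (P t)" using X fP by blast
      show "\<forall>t\<in>X. \<forall>t'\<in>X. t \<noteq> t' \<longrightarrow> P t \<inter> P t' = {}"
        using X disj unfolding disjoint_family_on_def by blast
    qed
    also have "\<dots> = r * card X" using X P(2) by (simp add: subset_iff)
    finally show "prod d X * p ^ card (\<Union>t\<in>X. P t) = (\<Prod>t\<in>X. d t * p ^ r) * (\<Prod>t\<in>R-X. 1)"
      by (simp add: prod.distrib power_mult)
  qed
  also have "\<dots> = (\<Prod>t\<in>R. d t * p ^ r + 1)"
    by (rule prod_add[OF fin(2), symmetric])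
  finally show ?thesis .
qed

section \<open>Exponential moments of Walsh sums\<close>

lemma exp_le_quadratic:
  fixes x :: real
  assumes "\<bar>x\<bar> \<le> 1"
  shows "exp x \<le> 1 + x + x\<^sup>2"
proof (cases "x \<ge> 0")
  case True
  thus ?thesis using exp_bound[of x] assms by simp
next
  case False
  define y where "y = - x"
  have y: "0 < y" "y \<le> 1" using False assms by (auto simp: y_def)
  have "1 + y + y\<^sup>2 / 2 \<le> exp y" using exp_lower_Taylor_quadratic[of y] y by simp
  \<comment> \<open>With the Taylor bound on \<open>exp y\<close>, this gives the estimate for
    negative \<open>x\<close> by taking reciprocals.\<close>
  moreover have "1 \<le> (1 - y + y\<^sup>2) * (1 + y + y\<^sup>2 / 2)"
  proof -
    have "(1 - y + y\<^sup>2) * (1 + y + y\<^sup>2 / 2) = 1 + (y\<^sup>2 + y ^ 3 + y ^ 4) / 2"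
      by (simp add: field_simps power2_eq_square power3_eq_cube power4_eq_xxxx)
    thus ?thesis using y by simp
  qed
  moreover have "0 < 1 - y + y\<^sup>2" using y by (simp add: add_nonneg_pos)
  ultimately have "1 \<le> (1 - y + y\<^sup>2) * exp y"
    by (meson less_imp_le mult_left_mono order_trans)
  hence "exp (- y) \<le> 1 - y + y\<^sup>2" by (simp add: exp_minus field_simps)
  thus ?thesis by (simp add: y_def)
qed

text \<open>
  The set of \<open>t\<close> with \<open>t \<in> S\<close> and \<open>s \<oplus> t \<in> S\<close> is invariant under translation by \<open>s\<close>. Keeping one element
  of each coset \<open>{t, s \<oplus> t}\<close> makes the events \<open>{t, s \<oplus> t} \<subseteq> S\<close> independent.
\<close>

definition coset_reps :: "nat \<Rightarrow> nat \<Rightarrow> nat set" where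
  "coset_reps k s = {t \<in> {1..<2 ^ k}. t < s \<oplus> t}"

definition half_walsh_sum :: "nat \<Rightarrow> nat \<Rightarrow> nat \<Rightarrow> nat set \<Rightarrow> real" where
  "half_walsh_sum k s c S = (\<Sum>t\<in>coset_reps k s. walsh k c t * of_bool ({t, s \<oplus> t} \<subseteq> S))"

text \<open>Translation by \<open>s\<close> has no fixed point and exchanges 0 and \<open>s\<close>,
  so it pairs off the remaining elements; the smaller one of each pair is kept.\<close>

lemma sum_coset_reps:
  fixes f :: "nat \<Rightarrow> real"
  assumes s: "s < 2 ^ k" "s \<noteq> 0" and f: "\<And>t. f (s \<oplus> t) = f t"
  shows "(\<Sum>t\<in>{1..<2 ^ k} - {s}. f t) = 2 * (\<Sum>t\<in>coset_reps k s. f t)"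
proof -
  have ne: "s \<oplus> t \<noteq> t" for t using s(2) xor_eq_self_iff(1)[of t s] by (metis xor.commute)
  have "{1..<2 ^ k} - {s} = coset_reps k s \<union> (\<lambda>t. s \<oplus> t) ` coset_reps k s"
  proof (intro equalityI subsetI)
    fix t assume t: "t \<in> {1..<2 ^ k} - {s}"
    have st: "s \<oplus> t < 2 ^ k" using t s xor_less_power2 by auto
    have st0: "1 \<le> s \<oplus> t"
    proof (rule ccontr)
      assume "\<not> 1 \<le> s \<oplus> t"
      hence "s \<oplus> t = 0" by linarith
      thus False using t by auto
    qed
    show "t \<in> coset_reps k s \<union> (\<lambda>t. s \<oplus> t) ` coset_reps k s"
    proof (cases "t < s \<oplus> t")
      case True
      thus ?thesis using t by (auto simp: coset_reps_def)
    next
      case False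
      hence "s \<oplus> t < t" using ne[of t] by linarith
      hence "s \<oplus> t \<in> coset_reps k s" using st st0 by (simp add: coset_reps_def)
      moreover have "t = s \<oplus> (s \<oplus> t)" by simp
      ultimately show ?thesis by blast
    qed
  next
    fix t assume "t \<in> coset_reps k s \<union> (\<lambda>t. s \<oplus> t) ` coset_reps k s"
    thus "t \<in> {1..<2 ^ k} - {s}"
    proof
      assume "t \<in> coset_reps k s"
      thus ?thesis by (auto simp: coset_reps_def)
    next
      assume "t \<in> (\<lambda>t. s \<oplus> t) ` coset_reps k s"
      then obtain r where r: "t = s \<oplus> r" "r \<in> coset_reps k s" by blast
      hence "t < 2 ^ k" "r < t" "r \<noteq> 0" using s(1) xor_less_power2[of s k r] by (auto simp: coset_reps_def)
      moreover have "t \<noteq> s" using r(1) \<open>r \<noteq> 0\<close> by simp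
      ultimately show ?thesis by auto
    qed
  qed
  moreover have "coset_reps k s \<inter> (\<lambda>t. s \<oplus> t) ` coset_reps k s = {}"
    by (auto simp: coset_reps_def)
  ultimately have "(\<Sum>t\<in>{1..<2 ^ k} - {s}. f t) = sum f (coset_reps k s) + sum f ((\<lambda>t. s \<oplus> t) ` coset_reps k s)"
    by (simp add: sum.union_disjoint coset_reps_def)
  also have "sum f ((\<lambda>t. s \<oplus> t) ` coset_reps k s) = sum f (coset_reps k s)"
  proof -
    have "inj_on (\<lambda>t. s \<oplus> t) (coset_reps k s)" by (rule inj_onI) (metis xor_left_self)
    thus ?thesis by (simp add: sum.reindex f)
  qed
  finally show ?thesis by simp
qed

lemma half_walsh_sum:
  assumes s: "s < 2 ^ k" "s \<noteq> 0" and c: "walsh k c s = 1" and S: "S \<subseteq> {1..<2 ^ k}"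
  shows "(\<Sum>t | t \<in> S \<and> s \<oplus> t \<in> S. walsh k c t) = 2 * half_walsh_sum k s c S"
proof -
  have "(\<Sum>t | t \<in> S \<and> s \<oplus> t \<in> S. walsh k c t)
    = (\<Sum>t\<in>{1..<2 ^ k} - {s}. walsh k c t * of_bool ({t, s \<oplus> t} \<subseteq> S))"
    by (rule sum.mono_neutral_cong_left) (use S in auto)
  also have "\<dots> = 2 * half_walsh_sum k s c S"
    unfolding half_walsh_sum_def by (rule sum_coset_reps[OF s]) (auto simp: walsh_xor c)
  finally show ?thesis .
qed

text \<open>By independence the mean is a product of factors
  \<open>1 + (exp (- \<theta> * walsh k c t) - 1) * p\<^sup>2\<close>, estimated by the quadratic
  bound and \<open>1 + x \<le> exp x\<close>. The linear terms add up to just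
  \<open>\<theta>\<close> because the character sums to -1 over the representatives.\<close>

lemma random_mean_exp_walsh:
  fixes p :: real
  assumes s: "s < 2 ^ k" "s \<noteq> 0" and c: "c < 2 ^ k" "c \<noteq> 0" "walsh k c s = 1"
    and \<theta>: "0 \<le> \<theta>" "\<theta> \<le> 1" and p: "0 \<le> p" "p \<le> 1"
  shows "random_mean {1..<2 ^ k} p (\<lambda>S. exp (- \<theta> * half_walsh_sum k s c S)) \<le> exp (p\<^sup>2 * (\<theta> + \<theta>\<^sup>2 * 2 ^ k))"
proof -
  let ?R = "coset_reps k s"
  have fin: "finite ?R" by (simp add: coset_reps_def)
  have mem: "s \<oplus> t < 2 ^ k" "t < s \<oplus> t" "0 < t" "t < 2 ^ k" if "t \<in> ?R" for t
    using that s(1) xor_less_power2 by (auto simp: coset_reps_def)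
  have "random_mean {1..<2 ^ k} p (\<lambda>S. exp (- \<theta> * half_walsh_sum k s c S))
    = random_mean {1..<2 ^ k} p (\<lambda>S. \<Prod>t\<in>?R. (exp (- \<theta> * walsh k c t) - 1) * of_bool ({t, s \<oplus> t} \<subseteq> S) + 1)"
    unfolding half_walsh_sum_def sum_distrib_left exp_sum[OF fin]
    by (intro random_mean_cong prod.cong refl) (auto simp: of_bool_def)
  also have "\<dots> = (\<Prod>t\<in>?R. (exp (- \<theta> * walsh k c t) - 1) * p\<^sup>2 + 1)"
  proof (rule random_mean_prod_disjoint)
    show "{t, s \<oplus> t} \<subseteq> {1..<2 ^ k}" if "t \<in> ?R" for t using mem[OF that] by auto
    show "card {t, s \<oplus> t} = 2" if "t \<in> ?R" for t using mem[OF that] by auto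
    show "disjoint_family_on (\<lambda>t. {t, s \<oplus> t}) ?R"
      unfolding disjoint_family_on_def
    proof (intro ballI impI)
      fix t t' assume t: "t \<in> ?R" "t' \<in> ?R" "t \<noteq> t'"
      have "t \<noteq> s \<oplus> t'" "s \<oplus> t \<noteq> t'"
        using mem(2)[OF t(1)] mem(2)[OF t(2)] by auto
      moreover have "s \<oplus> t \<noteq> s \<oplus> t'" using t(3) by (metis xor_left_self)
      ultimately show "{t, s \<oplus> t} \<inter> {t', s \<oplus> t'} = {}" using t(3) by auto
    qed
  qed (auto simp: fin)
  also have "\<dots> \<le> (\<Prod>t\<in>?R. exp (p\<^sup>2 * (- \<theta> * walsh k c t + \<theta>\<^sup>2)))"
  proof (intro prod_mono conjI)
    fix t
    have w2: "(walsh k c t)\<^sup>2 = 1" by (simp add: power2_eq_square)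
    have "\<bar>- \<theta> * walsh k c t\<bar> \<le> 1" using \<theta> walsh_cases[of k c t] by auto
    from exp_le_quadratic[OF this]
    have "exp (- \<theta> * walsh k c t) - 1 \<le> - \<theta> * walsh k c t + \<theta>\<^sup>2"
      by (simp add: power_mult_distrib w2)
    hence "(exp (- \<theta> * walsh k c t) - 1) * p\<^sup>2 + 1 \<le> 1 + p\<^sup>2 * (- \<theta> * walsh k c t + \<theta>\<^sup>2)"
      by (simp add: mult.commute mult_left_mono)
    also have "\<dots> \<le> exp (p\<^sup>2 * (- \<theta> * walsh k c t + \<theta>\<^sup>2))" by (rule exp_ge_add_one_self)
    finally show "(exp (- \<theta> * walsh k c t) - 1) * p\<^sup>2 + 1 \<le> exp (p\<^sup>2 * (- \<theta> * walsh k c t + \<theta>\<^sup>2))" .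
    \<comment> \<open>\<open>prod_mono\<close> also asks for nonnegative factors; this is where
      \<open>p \<le> 1\<close> enters.\<close>
    have "(1 - exp (- \<theta> * walsh k c t)) * p\<^sup>2 \<le> 1 * 1"
      using p by (intro mult_mono power_le_one) auto
    thus "0 \<le> (exp (- \<theta> * walsh k c t) - 1) * p\<^sup>2 + 1" by (simp add: algebra_simps)
  qed
  also have "\<dots> = exp (p\<^sup>2 * (- \<theta> * (\<Sum>t\<in>?R. walsh k c t) + \<theta>\<^sup>2 * card ?R))"
    by (simp add: exp_sum[OF fin, symmetric] sum_distrib_left sum.distrib sum_subtractf sum_negf ring_distribs mult_ac)
  also have "\<dots> \<le> exp (p\<^sup>2 * (\<theta> + \<theta>\<^sup>2 * 2 ^ k))"
  proof -
    \<comment> \<open>The sum over the whole group is zero; 0 and \<open>s\<close> contribute 2,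
      every other coset twice its representative.\<close>
    have "(\<Sum>t\<in>?R. walsh k c t) = - 1"
    proof -
      have "0 = (\<Sum>t<2 ^ k. walsh k c t)" using sum_walsh_eq_0[OF c(1,2)] by simp
      also have "{..<2 ^ k} = insert 0 (insert s ({1..<2 ^ k} - {s}))" using s by auto
      also have "sum (walsh k c) \<dots> = 2 + (\<Sum>t\<in>{1..<2 ^ k} - {s}. walsh k c t)"
      proof -
        define A where "A = {1..<2 ^ k} - {s}"
        have "finite A" "s \<notin> A" "0 \<notin> insert s A" using s(2) by (auto simp: A_def)
        hence "sum (walsh k c) (insert 0 (insert s A)) = 2 + sum (walsh k c) A" using c(3) by simp
        thus ?thesis by (simp only: A_def)
      qed
      also have "\<dots> = 2 + 2 * (\<Sum>t\<in>?R. walsh k c t)"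
        by (subst sum_coset_reps[OF s]) (auto simp: walsh_xor c)
      finally show ?thesis by simp
    qed
    moreover have "card ?R \<le> 2 ^ k"
      using card_mono[of "{..<2 ^ k}" ?R] by (auto simp: coset_reps_def)
    ultimately show ?thesis by (simp add: mult_left_mono)
  qed
  finally show ?thesis .
qed

section \<open>Common neighbours and disjoint translates\<close>

text \<open>These differences are excluded so that the triples
  \<open>{x, x \<oplus> a, x \<oplus> b}\<close> with \<open>x\<close> in \<open>X\<close> are
  pairwise disjoint.\<close>

definition xor_spread :: "nat \<Rightarrow> nat \<Rightarrow> nat set \<Rightarrow> bool" where
  "xor_spread a b X \<longleftrightarrow> (\<forall>x\<in>X. \<forall>y\<in>X. x \<noteq> y \<longrightarrow> x \<oplus> y \<notin> {a, b, a \<oplus> b})"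

definition translates :: "nat \<Rightarrow> nat \<Rightarrow> nat set \<Rightarrow> nat set" where
  "translates a b X = (\<Union>x\<in>X. {x, x \<oplus> a, x \<oplus> b})"

lemma card_translates:
  assumes ab: "a \<noteq> 0" "b \<noteq> 0" "a \<noteq> b" and X: "finite X" "xor_spread a b X"
  shows "card (translates a b X) = 3 * card X"
proof -
  have "card (translates a b X) = (\<Sum>x\<in>X. card {x, x \<oplus> a, x \<oplus> b})"
    unfolding translates_def
  proof (rule card_UN_disjoint)
    show "\<forall>x\<in>X. \<forall>y\<in>X. x \<noteq> y \<longrightarrow> {x, x \<oplus> a, x \<oplus> b} \<inter> {y, y \<oplus> a, y \<oplus> b} = {}"
    proof (intro ballI impI)
      fix x y assume xy: "x \<in> X" "y \<in> X" "x \<noteq> y"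
      hence n: "x \<oplus> y \<noteq> a" "x \<oplus> y \<noteq> b" "x \<oplus> y \<noteq> a \<oplus> b"
        using X(2) by (auto simp: xor_spread_def)
      have eq: "x \<oplus> u = y \<oplus> v \<longleftrightarrow> x \<oplus> y = u \<oplus> v" for u v
        by (metis xor.assoc xor.commute xor_left_self)
      have "x \<oplus> u \<noteq> y \<oplus> v" if "u \<in> {0, a, b}" "v \<in> {0, a, b}" for u v
        unfolding eq using that n xy(3) by (auto simp: xor.commute)
      from this[of 0 0] this[of 0 a] this[of 0 b] this[of a 0] this[of a a] this[of a b]
        this[of b 0] this[of b a] this[of b b]
      show "{x, x \<oplus> a, x \<oplus> b} \<inter> {y, y \<oplus> a, y \<oplus> b} = {}" by auto
    qed
  qed (use X in auto)
  also have "\<dots> = (\<Sum>x\<in>X. 3)"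
  proof (rule sum.cong[OF refl])
    fix x
    have "x \<noteq> x \<oplus> a" "x \<noteq> x \<oplus> b" "x \<oplus> a \<noteq> x \<oplus> b"
      using ab by (auto dest: arg_cong[where f = "\<lambda>y. x \<oplus> y"])
    thus "card {x, x \<oplus> a, x \<oplus> b} = 3" by simp
  qed
  finally show ?thesis by simp
qed

text \<open>Greedy choice: taking \<open>x\<close> removes at most the four elements of its coset
  \<open>D\<close> modulo \<open>a\<close> and \<open>b\<close>.\<close>

lemma xor_spread_subset_exists:
  assumes "finite A"
  shows "\<exists>X\<subseteq>A. xor_spread a b X \<and> card A \<le> 4 * card X"
  using assms
proof (induction A rule: finite_psubset_induct)
  case (psubset A)
  show ?case
  proof (cases "A = {}")
    case True
    thus ?thesis by (auto simp: xor_spread_def)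
  next
    case False
    then obtain x where x: "x \<in> A" by auto
    define D where "D = {x, x \<oplus> a, x \<oplus> b, x \<oplus> (a \<oplus> b)}"
    have "A - D \<subset> A" using x by (auto simp: D_def)
    from psubset.IH[OF this] obtain X where X: "X \<subseteq> A - D" "xor_spread a b X" "card (A - D) \<le> 4 * card X"
      by auto
    have finX: "finite X" using X(1) psubset.hyps by (auto intro: finite_subset)
    have xX: "x \<notin> X" using X(1) by (auto simp: D_def)
    have "xor_spread a b (insert x X)"
    proof -
      have "x \<oplus> y \<notin> {a, b, a \<oplus> b}" "y \<oplus> x \<notin> {a, b, a \<oplus> b}" if "y \<in> X" for y
      proof -
        have "y \<notin> D" using X(1) that by auto
        thus "x \<oplus> y \<notin> {a, b, a \<oplus> b}" unfolding D_def by (auto simp: xor_eq_iff)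
        thus "y \<oplus> x \<notin> {a, b, a \<oplus> b}" by (simp add: xor.commute)
      qed
      thus ?thesis using X(2) unfolding xor_spread_def by blast
    qed
    moreover have "card A \<le> 4 * card (insert x X)"
    proof -
      have "card A \<le> card (A - D) + card D"
        by (metis Diff_partition Un_Diff_cancel2 card_Un_le card_mono finite_Un finite_Diff psubset.hyps
            sup_commute sup_ge1 D_def finite.emptyI finite_insert order_trans)
      also have "card D \<le> 4" unfolding D_def by (simp add: card_insert_if)
      finally show ?thesis using X(3) xX finX by simp
    qed
    ultimately show ?thesis using X(1) x by (intro exI[of _ "insert x X"]) auto
  qed
qed

definition spread_sets :: "nat \<Rightarrow> nat \<Rightarrow> nat \<Rightarrow> nat \<Rightarrow> nat set set" where
  "spread_sets k j a b = {X. X \<subseteq> {..<2 ^ k} \<and> card X = j \<and> xor_spread a b X \<and> translates a b X \<subseteq> {1..<2 ^ k}}"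

lemma finite_spread_sets [simp]: "finite (spread_sets k j a b)"
  by (rule finite_subset[of _ "Pow {..<2 ^ k}"]) (auto simp: spread_sets_def)

lemma card_spread_sets: "card (spread_sets k j a b) \<le> (2 ^ k) ^ j"
proof -
  have "card (spread_sets k j a b) \<le> card {X. X \<subseteq> {..<2 ^ k :: nat} \<and> card X = j}"
    by (rule card_mono) (auto simp: spread_sets_def)
  also have "\<dots> = (2 ^ k) choose j" by (simp add: n_subsets)
  also have "\<dots> \<le> (2 ^ k) ^ j" by (cases "j \<le> 2 ^ k") (auto intro: binomial_le_pow simp: binomial_eq_0)
  finally show ?thesis .
qed

text \<open>More than \<open>4 * j\<close> common neighbours would contain a spread set with more
  than \<open>j\<close> elements, and a part of it with exactly \<open>j\<close> would be a
  forbidden witness.\<close>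

lemma common_le_of_no_spread_set:
  assumes ab: "a < 2 ^ k" "b < 2 ^ k" and S: "S \<subseteq> {1..<2 ^ k}"
    and none: "\<And>X. X \<in> spread_sets k j a b \<Longrightarrow> \<not> translates a b X \<subseteq> S"
  shows "card {x \<in> S. x \<oplus> a \<in> S \<and> x \<oplus> b \<in> S} \<le> 4 * j"
proof -
  let ?A = "{x \<in> S. x \<oplus> a \<in> S \<and> x \<oplus> b \<in> S}"
  have "finite ?A" using S by (auto intro: finite_subset)
  from xor_spread_subset_exists[OF this, of a b] obtain X where X: "X \<subseteq> ?A" "xor_spread a b X" "card ?A \<le> 4 * card X"
    by blast
  have "card X \<le> j"
  proof (rule ccontr)
    assume "\<not> card X \<le> j"
    then obtain Y where Y: "Y \<subseteq> X" "card Y = j"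
      by (meson nle_le obtain_subset_with_card_n)
    have t: "translates a b Y \<subseteq> S" using Y(1) X(1) by (auto simp: translates_def)
    have "xor_spread a b Y" using X(2) Y(1) by (auto simp: xor_spread_def)
    hence "Y \<in> spread_sets k j a b"
      using t Y X(1) S by (fastforce simp: spread_sets_def)
    thus False using none t by blast
  qed
  thus ?thesis using X(3) by simp
qed

text \<open>Union bound: there are at most \<open>(2 ^ k) ^ j\<close> witnesses, and the translates
  of each form a set of \<open>3 * j\<close> points.\<close>

lemma random_mean_spread_sets:
  fixes p :: real
  assumes ab: "a \<noteq> 0" "b \<noteq> 0" "a \<noteq> b" and p: "0 \<le> p"
  shows "random_mean {1..<2 ^ k} p (\<lambda>S. \<Sum>X\<in>spread_sets k j a b. of_bool (translates a b X \<subseteq> S))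
    \<le> (2 ^ k * p ^ 3) ^ j"
proof -
  have "random_mean {1..<2 ^ k} p (\<lambda>S. \<Sum>X\<in>spread_sets k j a b. of_bool (translates a b X \<subseteq> S))
    = (\<Sum>X\<in>spread_sets k j a b. p ^ (3 * j))"
    unfolding random_mean_sum
  proof (intro sum.cong refl)
    fix X assume X: "X \<in> spread_sets k j a b"
    hence "finite X" by (auto simp: spread_sets_def intro: finite_subset)
    hence "card (translates a b X) = 3 * j"
      using X ab by (simp add: spread_sets_def card_translates)
    thus "random_mean {1..<2 ^ k} p (\<lambda>S. of_bool (translates a b X \<subseteq> S)) = p ^ (3 * j)"
      using X by (subst random_mean_subset) (auto simp: spread_sets_def)
  qed
  also have "\<dots> = card (spread_sets k j a b) * p ^ (3 * j)" by simp
  also have "\<dots> \<le> real ((2 ^ k) ^ j) * p ^ (3 * j)"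
    using p card_spread_sets by (intro mult_right_mono of_nat_mono) auto
  also have "\<dots> = (2 ^ k * p ^ 3) ^ j" by (simp add: power_mult_distrib power_mult)
  finally show ?thesis .
qed

lemma random_mean_triangles:
  fixes p :: real
  shows "random_mean {1..<2 ^ k :: nat} p (\<lambda>S. real (card {(s, t). s \<in> S \<and> t \<in> S \<and> s \<oplus> t \<in> S}))
    = (2 ^ k - 1) * (2 ^ k - 2) * p ^ 3"
proof -
  let ?U = "{1..<2 ^ k :: nat}"
  have less: "s \<oplus> t \<in> ?U" if "s \<in> ?U" "t \<in> ?U - {s}" for s t
  proof -
    have "s \<oplus> t \<noteq> 0" using that by auto
    hence "1 \<le> s \<oplus> t" by linarith
    thus ?thesis using that xor_less_power2[of s k t] by simp
  qed
  have "random_mean ?U p (\<lambda>S. real (card {(s, t). s \<in> S \<and> t \<in> S \<and> s \<oplus> t \<in> S}))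
    = random_mean ?U p (\<lambda>S. \<Sum>s\<in>?U. \<Sum>t\<in>?U - {s}. of_bool ({s, t, s \<oplus> t} \<subseteq> S))"
  proof (rule random_mean_cong)
    fix S assume S: "S \<subseteq> ?U"
    hence S0: "0 \<notin> S" by auto
    have "{(s, t). s \<in> S \<and> t \<in> S \<and> s \<oplus> t \<in> S} = {q \<in> (SIGMA s:?U. ?U - {s}). {fst q, snd q, fst q \<oplus> snd q} \<subseteq> S}"
      using S S0 by auto
    hence "real (card {(s, t). s \<in> S \<and> t \<in> S \<and> s \<oplus> t \<in> S})
      = (\<Sum>q\<in>(SIGMA s:?U. ?U - {s}). of_bool ({fst q, snd q, fst q \<oplus> snd q} \<subseteq> S))"
      by (simp only:) (rule sum_of_bool_eq_card[symmetric], simp)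
    also have "\<dots> = (\<Sum>s\<in>?U. \<Sum>t\<in>?U - {s}. of_bool ({s, t, s \<oplus> t} \<subseteq> S))"
      by (subst sum.Sigma) (auto simp: case_prod_beta)
    finally show "real (card {(s, t). s \<in> S \<and> t \<in> S \<and> s \<oplus> t \<in> S})
      = (\<Sum>s\<in>?U. \<Sum>t\<in>?U - {s}. of_bool ({s, t, s \<oplus> t} \<subseteq> S))" .
  qed
  also have "\<dots> = (\<Sum>s\<in>?U. \<Sum>t\<in>?U - {s}. p ^ 3)"
    unfolding random_mean_sum
  proof (intro sum.cong refl)
    fix s t assume st: "s \<in> ?U" "t \<in> ?U - {s}"
    have "card {s, t, s \<oplus> t} = 3"
    proof -
      have "s \<noteq> s \<oplus> t" "t \<noteq> s \<oplus> t" "s \<noteq> t"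
        using st xor_eq_self_iff(1)[of t s] by (auto simp: xor.commute)
      thus ?thesis by simp
    qed
    thus "random_mean ?U p (\<lambda>S. of_bool ({s, t, s \<oplus> t} \<subseteq> S)) = p ^ 3"
      using st less[OF st] by (subst random_mean_subset) auto
  qed
  also have "\<dots> = (\<Sum>s\<in>?U. real (card (?U - {s})) * p ^ 3)" by simp
  also have "\<dots> = (\<Sum>s\<in>?U. (2 ^ k - 2) * p ^ 3)"
  proof (intro sum.cong refl)
    fix s assume "s \<in> ?U"
    \<comment> \<open>Having \<open>s\<close> in the range forces \<open>2 \<le> 2 ^ k\<close>, so
      subtraction on naturals agrees with that on reals.\<close>
    hence "card (?U - {s}) = 2 ^ k - 2" "(2::nat) \<le> 2 ^ k" by auto
    thus "real (card (?U - {s})) * p ^ 3 = (2 ^ k - 2) * p ^ 3" by (simp add: of_nat_diff)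
  qed
  also have "\<dots> = (2 ^ k - 1) * (2 ^ k - 2) * p ^ 3" by (simp add: of_nat_diff)
  finally show ?thesis .
qed

lemma random_mean_card:
  fixes p :: real
  assumes "finite U"
  shows "random_mean U p (\<lambda>S. real (card S)) = card U * p"
proof -
  have "random_mean U p (\<lambda>S. real (card S)) = random_mean U p (\<lambda>S. \<Sum>x\<in>U. of_bool ({x} \<subseteq> S))"
  proof (rule random_mean_cong)
    fix S assume "S \<subseteq> U"
    hence "{x \<in> U. {x} \<subseteq> S} = S" by auto
    thus "real (card S) = (\<Sum>x\<in>U. of_bool ({x} \<subseteq> S))"
      by (simp add: sum_of_bool_eq_card[OF assms])
  qed
  also have "\<dots> = (\<Sum>x\<in>U. p)"
    unfolding random_mean_sum
    using random_mean_subset[OF assms] by (intro sum.cong refl) force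
  finally show ?thesis by simp
qed

section \<open>Choice of the parameters\<close>

text \<open>First moment method: one function \<open>g\<close> rewards triangles and penalizes
  elements of \<open>S\<close>, large negative Walsh sums (\<open>\<Phi>1\<close>) and witnesses of
  many common neighbours (\<open>\<Phi>2\<close>). Its mean is positive.\<close>

lemma exists_spectral_sparse_set:
  fixes m :: nat
  assumes m: "m \<ge> 1"
  defines "k \<equiv> 3 * m" and "q \<equiv> 2 ^ m :: real"
  shows "\<exists>S\<subseteq>{1..<2 ^ k}. S \<noteq> {} \<and>
      (\<forall>s\<in>S. \<forall>c<2 ^ k. walsh k c s = 1 \<longrightarrow>
        (\<Sum>t | t \<in> S \<and> s \<oplus> t \<in> S. walsh k c t) \<ge> - (2 * ((12 * m + 7) * sqrt q))) \<and>
      (\<forall>a<2 ^ k. \<forall>b<2 ^ k. a \<noteq> 0 \<longrightarrow> b \<noteq> 0 \<longrightarrow> a \<noteq> b \<longrightarrow>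
        card {x \<in> S. x \<oplus> a \<in> S \<and> x \<oplus> b \<in> S} \<le> 4 * (4 * m + 2)) \<and>
      q / 8 * card S \<le> card {(s, t). s \<in> S \<and> t \<in> S \<and> s \<oplus> t \<in> S}"
proof -
  define N where "N = (2 ^ k :: real)"
  define U where "U = {1..<2 ^ k :: nat}"
  define j where "j = 4 * m + 2"
  define K where "K = 12 * real m + 7"
  \<comment> \<open>At this density \<open>N * p\<^sup>2 = q / 4\<close> governs the triangles per
    element and \<open>N * p ^ 3 = 1 / 8\<close> the common neighbours.\<close>
  define p where "p = 1 / (2 * q)"
  \<comment> \<open>Makes \<open>\<theta>\<^sup>2 * N * p\<^sup>2\<close> equal to
    \<open>1 / 4\<close>, so each exponential moment is at most \<open>exp 1\<close>; the deviation
    \<open>K / \<theta>\<close> becomes \<open>K * sqrt q\<close>.\<close>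
  define \<theta> where "\<theta> = 1 / sqrt q"
  define I1 where "I1 = {(s, c). s \<in> U \<and> c \<in> U \<and> walsh k c s = 1}"
  define I2 where "I2 = {(a, b). a \<in> U \<and> b \<in> U \<and> a \<noteq> b}"
  define \<Phi>1 where "\<Phi>1 S = (\<Sum>(s, c)\<in>I1. exp (- \<theta> * half_walsh_sum k s c S))" for S
  define \<Phi>2 where "\<Phi>2 S = (\<Sum>(a, b)\<in>I2. \<Sum>X\<in>spread_sets k j a b. of_bool (translates a b X \<subseteq> S) :: real)" for S
  define T where "T S = real (card {(s, t). s \<in> S \<and> t \<in> S \<and> s \<oplus> t \<in> S})" for S :: "nat set"
  \<comment> \<open>\<open>j\<close> and \<open>K\<close> make both error terms, \<open>N ^ 4 / 8 ^ j\<close> and \<open>N ^ 4 * exp (1 - K)\<close>, at most \<open>1 / 64\<close>.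
    Since \<open>T S \<le> N\<^sup>2\<close>, a set with \<open>g S > 0\<close> has many triangles and avoids all bad events.\<close>
  define g where "g S = T S - q / 8 * card S - N\<^sup>2 * (exp (- K) * \<Phi>1 S + \<Phi>2 S)" for S
  have q2: "q \<ge> 2" using power_increasing[OF m, of "2::real"] by (simp add: q_def)
  have Nq: "N = q ^ 3" by (simp add: N_def q_def k_def mult.commute flip: power_mult)
  have N8: "N = 8 ^ m" by (simp add: N_def k_def power_mult)
  have N_ge: "N \<ge> 8" using power_increasing[OF m, of "8::real"] by (simp add: N8)
  have p: "0 < p" "p \<le> 1 / 4" using q2 by (auto simp: p_def field_simps)
  have \<theta>: "0 < \<theta>" "\<theta> \<le> 1" "\<theta>\<^sup>2 = 1 / q"
    using q2 by (auto simp: \<theta>_def power_divide)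
  have Np2: "N * p\<^sup>2 = q / 4" using q2 by (simp add: Nq p_def power_divide field_simps power2_eq_square power3_eq_cube)
  have Np3: "N * p ^ 3 = 1 / 8" using q2 by (simp add: Nq p_def power_divide power_mult_distrib)
  have finU: "finite U" and cardU: "real (card U) = N - 1"
    by (simp_all add: U_def N_def of_nat_diff)
  have fin: "finite I1" "finite I2"
    by (rule finite_subset[of _ "U \<times> U"]; auto simp: I1_def I2_def finU)+
  have card_I: "real (card I1) \<le> N\<^sup>2" "real (card I2) \<le> N\<^sup>2"
  proof -
    have "real (card (U \<times> U)) \<le> N\<^sup>2"
      using N_ge unfolding card_cartesian_product of_nat_mult cardU power2_eq_square by (intro mult_mono) auto
    moreover have "card I1 \<le> card (U \<times> U)" "card I2 \<le> card (U \<times> U)"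
      by (rule card_mono; auto simp: I1_def I2_def finU)+
    ultimately show "real (card I1) \<le> N\<^sup>2" "real (card I2) \<le> N\<^sup>2" by linarith+
  qed
  have mean1: "random_mean U p \<Phi>1 \<le> N\<^sup>2 * exp 1"
  proof -
    have "random_mean U p \<Phi>1 = (\<Sum>(s, c)\<in>I1. random_mean U p (\<lambda>S. exp (- \<theta> * half_walsh_sum k s c S)))"
      unfolding \<Phi>1_def case_prod_beta by (rule random_mean_sum)
    also have "\<dots> \<le> (\<Sum>(s, c)\<in>I1. exp 1)"
    proof (intro sum_mono, clarify)
      fix s c assume "(s, c) \<in> I1"
      hence sc: "s < 2 ^ k" "s \<noteq> 0" "c < 2 ^ k" "c \<noteq> 0" "walsh k c s = 1"
        by (auto simp: I1_def U_def)
      have "random_mean U p (\<lambda>S. exp (- \<theta> * half_walsh_sum k s c S)) \<le> exp (p\<^sup>2 * (\<theta> + \<theta>\<^sup>2 * 2 ^ k))"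
        unfolding U_def using sc \<theta> p by (intro random_mean_exp_walsh) auto
      also have "p\<^sup>2 * (\<theta> + \<theta>\<^sup>2 * 2 ^ k) = p\<^sup>2 * \<theta> + \<theta>\<^sup>2 * (N * p\<^sup>2)"
        by (simp add: N_def algebra_simps)
      also have "\<dots> = p\<^sup>2 * \<theta> + 1 / 4" using q2 by (simp add: Np2 \<theta>(3))
      also have "p\<^sup>2 * \<theta> \<le> (1 / 4)\<^sup>2 * 1" using p \<theta> by (intro mult_mono power_mono) auto
      finally show "random_mean U p (\<lambda>S. exp (- \<theta> * half_walsh_sum k s c S)) \<le> exp 1"
        by (simp add: power2_eq_square order_trans)
    qed
    also have "\<dots> = card I1 * exp 1" by (simp add: case_prod_beta)
    also have "\<dots> \<le> N\<^sup>2 * exp 1" using card_I by (intro mult_right_mono) auto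
    finally show ?thesis .
  qed
  have mean2: "random_mean U p \<Phi>2 \<le> N\<^sup>2 * (1 / 8) ^ j"
  proof -
    have "random_mean U p \<Phi>2 = (\<Sum>(a, b)\<in>I2. random_mean U p (\<lambda>S. \<Sum>X\<in>spread_sets k j a b. of_bool (translates a b X \<subseteq> S)))"
      unfolding \<Phi>2_def case_prod_beta by (rule random_mean_sum)
    also have "\<dots> \<le> (\<Sum>(a, b)\<in>I2. (N * p ^ 3) ^ j)"
    proof (intro sum_mono, clarify)
      fix a b assume "(a, b) \<in> I2"
      thus "random_mean U p (\<lambda>S. \<Sum>X\<in>spread_sets k j a b. of_bool (translates a b X \<subseteq> S)) \<le> (N * p ^ 3) ^ j"
        unfolding U_def N_def using p by (intro random_mean_spread_sets) (auto simp: I2_def U_def)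
    qed
    also have "\<dots> = card I2 * (1 / 8) ^ j" by (simp add: case_prod_beta Np3)
    also have "\<dots> \<le> N\<^sup>2 * (1 / 8) ^ j" using card_I by (intro mult_right_mono) auto
    finally show ?thesis .
  qed
  have "random_mean U p g = random_mean U p T - q / 8 * random_mean U p (\<lambda>S. real (card S))
      - N\<^sup>2 * (exp (- K) * random_mean U p \<Phi>1 + random_mean U p \<Phi>2)"
    unfolding g_def random_mean_diff random_mean_cmult random_mean_add by simp
  also have "random_mean U p T = (N - 1) * (N - 2) * p ^ 3"
    unfolding U_def N_def T_def by (rule random_mean_triangles)
  also have "random_mean U p (\<lambda>S. real (card S)) = (N - 1) * p"
    by (simp add: random_mean_card[OF finU] cardU)
  finally have mean_g: "random_mean U p g = (N - 1) * p * (q / 8 - 2 * p\<^sup>2)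
      - N\<^sup>2 * (exp (- K) * random_mean U p \<Phi>1 + random_mean U p \<Phi>2)"
  proof -
    have "(N - 1) * (N - 2) * p ^ 3 - q / 8 * ((N - 1) * p) = (N - 1) * p * (N * p\<^sup>2 - 2 * p\<^sup>2 - q / 8)"
      by (simp add: algebra_simps power2_eq_square power3_eq_cube)
    also have "\<dots> = (N - 1) * p * (q / 8 - 2 * p\<^sup>2)" unfolding Np2 by simp
    finally show "random_mean U p g = (N - 1) * (N - 2) * p ^ 3 - q / 8 * ((N - 1) * p)
      - N\<^sup>2 * (exp (- K) * random_mean U p \<Phi>1 + random_mean U p \<Phi>2) \<Longrightarrow> ?thesis" by simp
  qed
  \<comment> \<open>The gain is at least \<open>1 / 8\<close>, against errors of at most
    \<open>1 / 32\<close> in total.\<close>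
  have main: "(N - 1) * p * (q / 8 - 2 * p\<^sup>2) \<ge> 1 * (1 / 8)"
  proof (intro mult_mono)
    have "1 \<le> (q * q) / 4" using mult_mono[OF q2 q2] q2 by simp
    also have "\<dots> = N / 2 * p" using q2 by (simp add: Nq p_def power3_eq_cube)
    also have "\<dots> \<le> (N - 1) * p" using p N_ge by (intro mult_right_mono) auto
    finally show "1 \<le> (N - 1) * p" .
    have "p\<^sup>2 \<le> (1 / 4)\<^sup>2" using p by (intro power_mono) auto
    thus "1 / 8 \<le> q / 8 - 2 * p\<^sup>2" using q2 by (simp add: power2_eq_square)
  qed (use p N_ge in auto)
  have N4: "N ^ 4 = 8 ^ (4 * m)" by (simp add: N8 mult.commute flip: power_mult)
  have err: "N\<^sup>2 * (exp (- K) * random_mean U p \<Phi>1 + random_mean U p \<Phi>2) \<le> 1 / 64 + 1 / 64"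
  proof -
    have "N\<^sup>2 * (exp (- K) * random_mean U p \<Phi>1 + random_mean U p \<Phi>2)
      \<le> N\<^sup>2 * (exp (- K) * (N\<^sup>2 * exp 1) + N\<^sup>2 * (1 / 8) ^ j)"
      using mean1 mean2 by (intro mult_left_mono add_mono) auto
    also have "\<dots> = N ^ 4 * exp (1 - K) + N ^ 4 * (1 / 8) ^ j"
      by (simp add: exp_diff exp_minus field_simps power2_eq_square power4_eq_xxxx)
    also have "N ^ 4 * (1 / 8) ^ j = 1 / 64"
      by (simp add: N4 j_def power_add power_divide power2_eq_square)
    also have "N ^ 4 * exp (1 - K) \<le> 1 / 64"
    proof -
      \<comment> \<open>The exponent equals \<open>K - 1\<close>, so replacing 2 by
        \<open>exp 1\<close> suffices.\<close>
      have "64 * N ^ 4 = 2 ^ (12 * m + 6)"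
        unfolding N4 by (simp add: power_add power_mult)
      also have "\<dots> \<le> exp 1 ^ (12 * m + 6)"
        using exp_ge_add_one_self[of 1] by (intro power_mono) auto
      also have "\<dots> = exp (K - 1)" by (simp add: K_def flip: exp_of_nat_mult)
      finally show ?thesis by (simp add: exp_diff field_simps)
    qed
    finally show ?thesis by simp
  qed
  have "random_mean U p g > 0" using mean_g main err by simp
  then obtain S where S: "S \<subseteq> U" "g S > 0"
    using p by (rule_tac random_mean_pos_imp_ex[of p U g]) auto
  have finS: "finite S" using S(1) finU by (rule finite_subset)
  have \<Phi>0: "\<Phi>1 S \<ge> 0" "\<Phi>2 S \<ge> 0"
    unfolding \<Phi>1_def \<Phi>2_def by (auto intro!: sum_nonneg)
  have "0 \<le> N\<^sup>2 * (exp (- K) * \<Phi>1 S + \<Phi>2 S)" using \<Phi>0 by simp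
  hence ZS: "q / 8 * card S < T S" using S(2) by (simp add: g_def)
  have TN: "T S \<le> N\<^sup>2"
  proof -
    have "card {(s, t). s \<in> S \<and> t \<in> S \<and> s \<oplus> t \<in> S} \<le> card (U \<times> U)"
      using S(1) by (intro card_mono) (auto simp: finU)
    hence "T S \<le> real (card (U \<times> U))" by (simp add: T_def)
    also have "\<dots> \<le> N\<^sup>2"
      using N_ge unfolding card_cartesian_product of_nat_mult cardU power2_eq_square by (intro mult_mono) auto
    finally show ?thesis .
  qed
  have "exp (- K) * \<Phi>1 S + \<Phi>2 S < 1"
  proof -
    have "0 \<le> q / 8 * card S" using q2 by simp
    hence "N\<^sup>2 * (exp (- K) * \<Phi>1 S + \<Phi>2 S) < N\<^sup>2 * 1" using S(2) TN by (simp add: g_def)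
    thus ?thesis using N_ge by (simp only: mult_less_cancel_left_pos zero_less_power)
  qed
  moreover have "0 \<le> exp (- K) * \<Phi>1 S" using \<Phi>0 by (intro mult_nonneg_nonneg) auto
  ultimately have \<Phi>lt: "exp (- K) * \<Phi>1 S < 1" "\<Phi>2 S < 1"
    using \<Phi>0 by linarith+
  have ne: "S \<noteq> {}"
    using ZS by (auto simp: T_def)
  have spec: "(\<Sum>t | t \<in> S \<and> s \<oplus> t \<in> S. walsh k c t) \<ge> - (2 * ((12 * m + 7) * sqrt q))"
    if s: "s \<in> S" and c: "c < 2 ^ k" "walsh k c s = 1" for s c
  proof (cases "c = 0")
    \<comment> \<open>The trivial character is not covered by \<open>I1\<close>, but its sum is
      nonnegative.\<close>
    case True
    have "0 \<le> (\<Sum>t | t \<in> S \<and> s \<oplus> t \<in> S. walsh k c t)" by (intro sum_nonneg) (simp add: True)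
    moreover have "0 \<le> 2 * ((12 * m + 7) * sqrt q)" using q2 by simp
    ultimately show ?thesis by linarith
  next
    case False
    have sU: "s < 2 ^ k" "s \<noteq> 0" using s S(1) by (auto simp: U_def)
    have I: "(s, c) \<in> I1" using sU c False by (auto simp: I1_def U_def)
    \<comment> \<open>A single term of \<open>\<Phi>1 S\<close> is below \<open>exp K\<close>, which
      bounds the half sum from below.\<close>
    have "exp (- \<theta> * half_walsh_sum k s c S) \<le> \<Phi>1 S"
      unfolding \<Phi>1_def
      using member_le_sum[OF I, of "\<lambda>(s, c). exp (- \<theta> * half_walsh_sum k s c S)"] fin(1) by auto
    hence "exp (- K) * exp (- \<theta> * half_walsh_sum k s c S) \<le> exp (- K) * \<Phi>1 S"
      by (intro mult_left_mono) auto
    hence "exp (- K + - \<theta> * half_walsh_sum k s c S) < 1"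
      using \<Phi>lt(1) unfolding exp_add by linarith
    hence "- \<theta> * half_walsh_sum k s c S < K" by simp
    hence "- half_walsh_sum k s c S < K * sqrt q" using q2 by (simp add: \<theta>_def field_simps)
    moreover have "K * sqrt q = (12 * m + 7) * sqrt q" by (simp add: K_def)
    moreover have "(\<Sum>t | t \<in> S \<and> s \<oplus> t \<in> S. walsh k c t) = 2 * half_walsh_sum k s c S"
      using S(1) unfolding U_def by (rule half_walsh_sum[OF sU c(2)])
    ultimately show ?thesis by linarith
  qed
  have common: "card {x \<in> S. x \<oplus> a \<in> S \<and> x \<oplus> b \<in> S} \<le> 4 * (4 * m + 2)"
    if ab: "a < 2 ^ k" "b < 2 ^ k" "a \<noteq> 0" "b \<noteq> 0" "a \<noteq> b" for a b
    unfolding j_def[symmetric]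
  proof (rule common_le_of_no_spread_set[OF ab(1,2)])
    fix X assume X: "X \<in> spread_sets k j a b"
    have I: "(a, b) \<in> I2" using ab by (auto simp: I2_def U_def)
    have "of_bool (translates a b X \<subseteq> S) \<le> (\<Sum>X\<in>spread_sets k j a b. of_bool (translates a b X \<subseteq> S) :: real)"
      by (rule member_le_sum[OF X]) auto
    also have "\<dots> \<le> \<Phi>2 S"
      unfolding \<Phi>2_def
      using member_le_sum[OF I, of "\<lambda>(a, b). \<Sum>X\<in>spread_sets k j a b. of_bool (translates a b X \<subseteq> S) :: real"] fin(2)
      by (auto intro: sum_nonneg)
    finally show "\<not> translates a b X \<subseteq> S" using \<Phi>lt(2) by auto
  qed (use S U_def in auto)
  show ?thesis
    using S(1) ne spec common ZS unfolding U_def T_def by (intro exI[of _ S]) auto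
qed

section \<open>Assembling the bounds for all large dimensions\<close>

text \<open>With \<open>t = 16 * m + 8\<close> common neighbours the clique bound gives the norm.
  With \<open>L = K * sqrt q\<close> and \<open>q / 8\<close> triangles per element the dual bound
  gives \<open>q / 8 / (2 * L)\<close>, which is \<open>sqrt q / (16 * K)\<close>.\<close>

lemma exists_poly_power8:
  assumes m: "m \<ge> 1" and n: "8 ^ m \<le> n"
  shows "\<exists>f. homogeneous_poly n 4 f \<and> nonneg_coeffs f \<and>
      poly_norm2 n f \<le> 24 * (real (16 * m + 8) * real (16 * m + 10)) \<and>
      Lambda_rep n f \<ge> sqrt (2 ^ m) / (16 * (12 * m + 7))"
proof -
  define k where "k = 3 * m"
  define q where "q = (2 ^ m :: real)"
  obtain S where S: "S \<subseteq> {1..<2 ^ k}" "S \<noteq> {}"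
    and spec: "\<And>s c. \<lbrakk>s \<in> S; c < 2 ^ k; walsh k c s = 1\<rbrakk> \<Longrightarrow>
      (\<Sum>t | t \<in> S \<and> s \<oplus> t \<in> S. walsh k c t) \<ge> - (2 * ((12 * m + 7) * sqrt q))"
    and common: "\<And>a b. \<lbrakk>a < 2 ^ k; b < 2 ^ k; a \<noteq> 0; b \<noteq> 0; a \<noteq> b\<rbrakk> \<Longrightarrow>
      card {x \<in> S. x \<oplus> a \<in> S \<and> x \<oplus> b \<in> S} \<le> 4 * (4 * m + 2)"
    and tri: "q / 8 * card S \<le> card {(s, t). s \<in> S \<and> t \<in> S \<and> s \<oplus> t \<in> S}"
    using exists_spectral_sparse_set[OF m] unfolding k_def q_def by meson
  have kn: "2 ^ k \<le> n" using n by (simp add: k_def power_mult)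
  interpret xor_hypergraph k n S by unfold_locales (use kn S in auto)
  have q: "q > 0" by (simp add: q_def)
  have cS: "real (card S) > 0" using S by (simp add: card_gt_0_iff)
  have "poly_norm2 n clique_poly \<le> real (24 * (4 * (4 * m + 2) * (4 * (4 * m + 2) + 2)))"
    by (rule poly_norm2_clique_poly) (rule common)
  also have "\<dots> = 24 * (real (16 * m + 8) * real (16 * m + 10))"
    by (simp add: algebra_simps)
  finally have norm: "poly_norm2 n clique_poly \<le> 24 * (real (16 * m + 8) * real (16 * m + 10))" .
  define K where "K = 12 * real m + 7"
  have K: "K > 0" by (simp add: K_def add_nonneg_pos)
  have "sqrt q / (16 * K) = q / 8 * card S / (2 * (K * sqrt q) * card S)"
  proof -
    have "r / (16 * K) = r * r / 8 * w / (2 * (K * r) * w)" if "r > 0" "w > 0" for r w :: real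
      using that K by (simp add: field_simps)
    from this[of "sqrt q" "real (card S)"] show ?thesis using q cS by simp
  qed
  also have "\<dots> \<le> triangles / (2 * (K * sqrt q) * card S)"
    using tri q K by (intro divide_right_mono) auto
  also have "\<dots> \<le> Lambda_rep n clique_poly"
  proof (rule Lambda_rep_clique_poly)
    show "0 < K * sqrt q" using K q by simp
  qed (use spec S(2) in \<open>simp_all add: K_def\<close>)
  finally have "Lambda_rep n clique_poly \<ge> sqrt (2 ^ m) / (16 * (12 * m + 7))"
    by (simp add: q_def K_def)
  thus ?thesis
    using norm homogeneous_quartic_poly nonneg_quartic_poly[of "\<lambda>i j u v. of_bool (hyperedge i j u v)"]
    by (intro exI[of _ clique_poly]) simp
qed

theorem theorem1p3:
  shows "\<exists>(C::nat) (k::nat) (c::real). c > 0 \<and>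
    (\<forall>\<^sub>F n::nat in sequentially. \<exists>f::mpoly.
       homogeneous_poly n 4 f \<and> nonneg_coeffs f \<and>
       poly_norm2 n f \<le> ln (real n) ^ C \<and>
       Lambda_rep n f \<ge> c * real n powr (1/6) / ln (real n) ^ k)"
proof -
  \<comment> \<open>\<open>14976 = 24 * 24 * 26\<close> is the constant in the norm bound; one extra
    logarithm absorbs it.\<close>
  have large: "\<forall>\<^sub>F n::nat in sequentially. ln (real n) \<ge> 14976"
    by (rule filterlim_at_top[THEN iffD1, rule_format, OF filterlim_compose[OF ln_at_top filterlim_real_sequentially]])
  have "\<forall>\<^sub>F n::nat in sequentially. \<exists>f::mpoly. homogeneous_poly n 4 f \<and> nonneg_coeffs f \<and>
      poly_norm2 n f \<le> ln (real n) ^ 3 \<and>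
      Lambda_rep n f \<ge> 1 / 608 * real n powr (1/6) / ln (real n) ^ 1"
    using large eventually_ge_at_top[of 8]
  proof eventually_elim
    case (elim n)
    \<comment> \<open>Rounding down to a power of 8 costs only a constant factor.\<close>
    obtain m where m: "8 ^ m \<le> n" "n < 8 ^ (m + 1)"
      using ex_power_ivl1[of 8 n] elim by auto
    have m1: "m \<ge> 1" using m elim by (cases m) auto
    define l where "l = ln (real n)"
    have ml: "real m \<le> l"
    proof -
      have "exp 1 \<le> (8::real)" using exp_le by linarith
      hence "1 \<le> ln (8::real)" by (simp add: ln_ge_iff)
      hence "real m \<le> m * ln 8" by (simp add: mult_le_cancel_left1)
      also have "\<dots> = ln (8 ^ m)" by (simp add: ln_realpow)
      also have "\<dots> \<le> l" unfolding l_def using m(1) elim by (subst ln_le_cancel_iff) (simp_all flip: of_nat_le_iff)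
      finally show ?thesis .
    qed
    have l: "l \<ge> 14976" using elim by (simp add: l_def)
    obtain f where f: "homogeneous_poly n 4 f" "nonneg_coeffs f"
      "poly_norm2 n f \<le> 24 * (real (16 * m + 8) * real (16 * m + 10))"
      "Lambda_rep n f \<ge> sqrt (2 ^ m) / (16 * (12 * m + 7))"
      using exists_poly_power8[OF m1 m(1)] by blast
    have "poly_norm2 n f \<le> 24 * (real (16 * m + 8) * real (16 * m + 10))" by (rule f)
    also have "\<dots> \<le> 24 * ((24 * l) * (26 * l))"
      using ml m1 by (intro mult_left_mono mult_mono) auto
    also have "\<dots> = 14976 * l\<^sup>2" by (simp add: power2_eq_square)
    also have "\<dots> \<le> l * l\<^sup>2" using l by (intro mult_right_mono) auto
    finally have norm: "poly_norm2 n f \<le> l ^ 3" by (simp add: power2_eq_square power3_eq_cube)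
    define r where "r = sqrt (2 ^ m)"
    have r: "r > 0" by (simp add: r_def)
    \<comment> \<open>\<open>(2 * r) ^ 6 = 64 * 8 ^ m\<close> exceeds
      \<open>8 ^ (m + 1)\<close>.\<close>
    have "real n powr (1/6) \<le> ((2 * r) ^ 6) powr (1/6)"
    proof (rule powr_mono2)
      have "r ^ 6 = (r\<^sup>2) ^ 3" by (simp flip: power_mult)
      also have "\<dots> = (2 ^ m) ^ 3" by (simp add: r_def)
      also have "\<dots> = 8 ^ m" by (simp flip: power_mult) (simp add: power_mult mult.commute[of m])
      finally have "r ^ 6 = 8 ^ m" .
      moreover have "real n < real (8 ^ (m + 1))" using m(2) by (simp only: of_nat_less_iff)
      ultimately show "real n \<le> (2 * r) ^ 6" by (simp add: power_mult_distrib)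
    qed auto
    also have "\<dots> = 2 * r"
    proof -
      have "(2 * r) powr 6 = (2 * r) ^ 6" using r by (intro powr_numeral) auto
      hence "((2 * r) ^ 6) powr (1/6) = ((2 * r) powr 6) powr (1/6)" by simp
      thus ?thesis using r unfolding powr_powr by simp
    qed
    finally have nr: "real n powr (1/6) \<le> 2 * r" .
    \<comment> \<open>\<open>608 = 2 * 16 * 19\<close>, where
      \<open>12 * m + 7 \<le> 19 * l\<close>.\<close>
    have "1 / 608 * real n powr (1/6) / l ^ 1 \<le> 1 / 608 * (2 * r) / l ^ 1"
      using nr l by (intro divide_right_mono mult_left_mono) auto
    also have "\<dots> = r / (16 * (19 * l))" by simp
    also have "\<dots> \<le> r / (16 * (12 * m + 7))"
      using r ml m1 l by (intro divide_left_mono mult_pos_pos) auto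
    also have "\<dots> \<le> Lambda_rep n f" using f(4) by (simp add: r_def)
    finally show ?case using f norm unfolding l_def by blast
  qed
  thus ?thesis by (intro exI[of _ 3] exI[of _ 1] exI[of _ "1 / 608"]) auto
qed

end
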